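(* Let $\mathcal M$ be a connected smooth manifold with $\dim \mathcal M \geq 4$, and let $\omega$ be a smooth $2$-form on $\mathcal M$ such that $$d\omega = \beta\wedge\omega$$ for some smooth $1$-form $\beta$ on $\mathcal M$. Assume that the set of points of $\mathcal M$ at which $\omega = 0$ is nowhere dense in $\mathcal M$. Define the subsets of $\mathcal M$ $$\mathcal A = \{ q : r(\omega)(q) > 2 \},\qquad \mathcal B = \{ q : (d\beta)_q \neq 0,\ \omega_q \neq 0\},\qquad \mathcal C = \{ q : r(\omega)(q) \leq 1\},$$ where $r$ denotes the pointwise rank of a $2$-form. Then: (a) $\mathcal A$ is open, and if $\mathcal A$ is non-empty then $d\beta = 0$ on $\mathcal A$; (b) if $\mathcal B$ is non-empty, then $1 \leq r(d\beta) \leq 2$ and $1\leq r(\omega) \leq 2$ at every point of $\mathcal B$; (c) if $\mathcal C$ is nowhere dense in $\mathcal M$, then $\beta$ is unique, i.e. any smooth $1$-form $\beta'$ on $\mathcal M$ with $d\omega = \beta'\wedge\omega$ equals $\beta$. In particular, $\mathcal A\cap\mathcal B = \emptyset$.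
   Context: The rank of a $2$-form $\Omega$ on a finite-dimensional real vector space is the largest integer $p \geq 0$ such that $\Omega^{\wedge p} \neq 0$ (so the rank is $0$ exactly when $\Omega = 0$, and in general $\Omega$ has kernel of codimension $2p$). For a $2$-form $\omega$ on a manifold $\mathcal M$, $r(\omega)$ denotes the function on $\mathcal M$ assigning to each point $q$ the rank of $\omega_q$ on $T_q\mathcal M$. *)

theory Defs
  imports "HOL-Analysis.Analysis" "HOL-Combinatorics.Permutations"
begin

section \<open>Exterior algebra\<close>

text \<open>
  A \<open>k\<close>-form on a real vector space with underlying set \<open>V\<close> is a function on lists of vectors;
  only its values on \<open>tuples V k\<close> are meaningful, so forms are compared on these tuples only.
\<close>

definition tuples :: "'v set \<Rightarrow> nat \<Rightarrow> 'v list set" where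
  "tuples V k = {vs. length vs = k \<and> set vs \<subseteq> V}"

definition form_eq :: "'v set \<Rightarrow> nat \<Rightarrow> ('v list \<Rightarrow> real) \<Rightarrow> ('v list \<Rightarrow> real) \<Rightarrow> bool" where
  "form_eq V k \<Omega> \<Theta> \<longleftrightarrow> (\<forall>vs \<in> tuples V k. \<Omega> vs = \<Theta> vs)"

abbreviation form_zero :: "'v set \<Rightarrow> nat \<Rightarrow> ('v list \<Rightarrow> real) \<Rightarrow> bool" where
  "form_zero V k \<Omega> \<equiv> form_eq V k \<Omega> (\<lambda>_. 0)"

text \<open>
  The normalisation is the one for which \<open>(\<alpha> \<and> \<theta>)(v, w) = \<alpha>(v) \<theta>(w) - \<alpha>(w) \<theta>(v)\<close> for
  \<open>1\<close>-forms; it goes together with the formula without prefactor for the exterior derivative below.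
\<close>

definition wedge ::
  "nat \<Rightarrow> nat \<Rightarrow> ('v list \<Rightarrow> real) \<Rightarrow> ('v list \<Rightarrow> real) \<Rightarrow> 'v list \<Rightarrow> real" where
  "wedge k l \<Omega> \<Theta> vs =
     (\<Sum>\<sigma> | \<sigma> permutes {..<k + l}.
        of_int (sign \<sigma>) * \<Omega> (map (\<lambda>i. vs ! \<sigma> i) [0..<k]) * \<Theta> (map (\<lambda>i. vs ! \<sigma> i) [k..<k + l]))
     / (fact k * fact l)"

primrec wedge_power :: "('v list \<Rightarrow> real) \<Rightarrow> nat \<Rightarrow> 'v list \<Rightarrow> real" where
  "wedge_power \<Omega> 0 = (\<lambda>_. 1)"
| "wedge_power \<Omega> (Suc p) = wedge 2 (2 * p) \<Omega> (wedge_power \<Omega> p)"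

definition form_rank :: "'v set \<Rightarrow> ('v list \<Rightarrow> real) \<Rightarrow> nat" where
  "form_rank V \<Omega> = (GREATEST p. \<not> form_zero V (2 * p) (wedge_power \<Omega> p))"


section \<open>Smooth manifolds\<close>

text \<open>Smoothness is only meaningful here for open sets \<open>S\<close>.\<close>

primrec Ck_on ::
  "nat \<Rightarrow> ('e::real_normed_vector \<Rightarrow> 'f::real_normed_vector) \<Rightarrow> 'e set \<Rightarrow> bool" where
  "Ck_on 0 f S \<longleftrightarrow> continuous_on S f"
| "Ck_on (Suc k) f S \<longleftrightarrow>
     (\<forall>x\<in>S. f differentiable (at x)) \<and> (\<forall>v. Ck_on k (\<lambda>x. frechet_derivative f (at x) v) S)"

definition smooth_on ::
  "('e::real_normed_vector \<Rightarrow> 'f::real_normed_vector) \<Rightarrow> 'e set \<Rightarrow> bool" where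
  "smooth_on f S \<longleftrightarrow> (\<forall>k. Ck_on k f S)"

text \<open>A chart is its domain together with the coordinate map (arbitrary outside the domain).\<close>

type_synonym ('a, 'e) chart = "'a set \<times> ('a \<Rightarrow> 'e)"

definition is_chart :: "'a topology \<Rightarrow> ('a, 'e::euclidean_space) chart \<Rightarrow> bool" where
  "is_chart X c \<longleftrightarrow> openin X (fst c) \<and> open (snd c ` fst c) \<and>
     homeomorphic_map (subtopology X (fst c)) (top_of_set (snd c ` fst c)) (snd c)"

definition transition :: "('a, 'e) chart \<Rightarrow> ('a, 'e) chart \<Rightarrow> 'e \<Rightarrow> 'e" where
  "transition c c' = snd c' \<circ> inv_into (fst c) (snd c)"

definition smooth_manifold ::
  "'a topology \<Rightarrow> ('a, 'e::euclidean_space) chart set \<Rightarrow> bool" where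
  "smooth_manifold X A \<longleftrightarrow>
     Hausdorff_space X \<and> second_countable X \<and>
     (\<forall>c\<in>A. is_chart X c) \<and> (\<Union>c\<in>A. fst c) = topspace X \<and>
     (\<forall>c\<in>A. \<forall>c'\<in>A. smooth_on (transition c c') (snd c ` (fst c \<inter> fst c')))"

definition nowhere_dense_in :: "'a topology \<Rightarrow> 'a set \<Rightarrow> bool" where
  "nowhere_dense_in X S \<longleftrightarrow> X interior_of (X closure_of S) = {}"


section \<open>Tangent spaces\<close>

text \<open>
  A tangent vector at \<open>q\<close> is an equivalence class of pairs of a chart around \<open>q\<close> and a coordinate
  vector, two pairs being identified if the derivative of the transition map carries one vector
  to the other. Such a class contains exactly one pair for each chart around \<open>q\<close>, so
  it is represented by the function from charts to coordinate vectors of which it is the graph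
  (extended by \<open>0\<close>). The vector space operations are pointwise.
\<close>

type_synonym ('a, 'e) tangent = "('a, 'e) chart \<Rightarrow> 'e"

definition charts_at :: "('a, 'e) chart set \<Rightarrow> 'a \<Rightarrow> ('a, 'e) chart set" where
  "charts_at A q = {c \<in> A. q \<in> fst c}"

definition tangent_space ::
  "('a, 'e::euclidean_space) chart set \<Rightarrow> 'a \<Rightarrow> ('a, 'e) tangent set" where
  "tangent_space A q =
     {t. (\<forall>c\<in>charts_at A q. \<forall>c'\<in>charts_at A q.
            t c' = frechet_derivative (transition c c') (at (snd c q)) (t c)) \<and>
         (\<forall>c. c \<notin> charts_at A q \<longrightarrow> t c = 0)}"

text \<open>The tangent vector at \<open>q\<close> with components \<open>v\<close> in the chart \<open>c\<close>.\<close>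

definition tangent_of ::
  "('a, 'e::euclidean_space) chart set \<Rightarrow> ('a, 'e) chart \<Rightarrow> 'a \<Rightarrow> 'e \<Rightarrow> ('a, 'e) tangent" where
  "tangent_of A c q v =
     (\<lambda>c'. if c' \<in> charts_at A q
           then frechet_derivative (transition c c') (at (snd c q)) v else 0)"


section \<open>Differential forms\<close>

type_synonym ('a, 'e) form = "'a \<Rightarrow> ('a, 'e) tangent list \<Rightarrow> real"

definition alternating_form ::
  "('a, 'e::euclidean_space) chart set \<Rightarrow> 'a \<Rightarrow> nat \<Rightarrow> (('a, 'e) tangent list \<Rightarrow> real) \<Rightarrow> bool" where
  "alternating_form A q k \<Omega> \<longleftrightarrow>
     (\<forall>ts \<in> tuples (tangent_space A q) k. \<forall>i<k.
        \<forall>u \<in> tangent_space A q. \<forall>w \<in> tangent_space A q. \<forall>a b.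
          \<Omega> (ts[i := (\<lambda>c. a *\<^sub>R u c + b *\<^sub>R w c)]) = a * \<Omega> (ts[i := u]) + b * \<Omega> (ts[i := w])) \<and>
     (\<forall>ts \<in> tuples (tangent_space A q) k. \<forall>i<k. \<forall>j<k. i \<noteq> j \<and> ts ! i = ts ! j \<longrightarrow> \<Omega> ts = 0)"

text \<open>The pullback of a form to the image of a chart, evaluated at constant vectors.\<close>

definition local_rep ::
  "('a, 'e::euclidean_space) chart set \<Rightarrow> ('a, 'e) chart \<Rightarrow> ('a, 'e) form \<Rightarrow> 'e \<Rightarrow> 'e list \<Rightarrow> real" where
  "local_rep A c \<omega> x vs =
     (let q = inv_into (fst c) (snd c) x in \<omega> q (map (tangent_of A c q) vs))"

definition smooth_form ::
  "'a topology \<Rightarrow> ('a, 'e::euclidean_space) chart set \<Rightarrow> nat \<Rightarrow> ('a, 'e) form \<Rightarrow> bool" where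
  "smooth_form X A k \<omega> \<longleftrightarrow>
     (\<forall>q \<in> topspace X. alternating_form A q k (\<omega> q)) \<and>
     (\<forall>c \<in> A. \<forall>vs. length vs = k \<longrightarrow> smooth_on (\<lambda>x. local_rep A c \<omega> x vs) (snd c ` fst c))"

definition wedge_form ::
  "nat \<Rightarrow> nat \<Rightarrow> ('a, 'e) form \<Rightarrow> ('a, 'e) form \<Rightarrow> ('a, 'e) form" where
  "wedge_form k l \<alpha> \<theta> = (\<lambda>q. wedge k l (\<alpha> q) (\<theta> q))"

text \<open>
  The exterior derivative of a \<open>k\<close>-form in a chart:
  \<open>d\<alpha>(v\<^sub>0, \<dots>, v\<^sub>k) = (\<Sum>i\<le>k. (-1)\<^sup>i D\<^bsub>v\<^sub>i\<^esub> (\<alpha>(v\<^sub>0, \<dots>, v\<^sub>k without v\<^sub>i)))\<close> for constant vectors.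
  On smooth forms its value does not depend on the chart around \<open>q\<close>, so any choice will do.
\<close>

definition ext_deriv_in ::
  "('a, 'e::euclidean_space) chart set \<Rightarrow> ('a, 'e) chart \<Rightarrow> nat \<Rightarrow> ('a, 'e) form \<Rightarrow> ('a, 'e) form" where
  "ext_deriv_in A c k \<omega> q ts =
     (\<Sum>i\<le>k. (-1) ^ i *
        frechet_derivative
          (\<lambda>x. local_rep A c \<omega> x (map (\<lambda>t. t c) (take i ts @ drop (Suc i) ts)))
          (at (snd c q)) ((ts ! i) c))"

definition ext_deriv ::
  "('a, 'e::euclidean_space) chart set \<Rightarrow> nat \<Rightarrow> ('a, 'e) form \<Rightarrow> ('a, 'e) form" where
  "ext_deriv A k \<omega> q = ext_deriv_in A (SOME c. c \<in> charts_at A q) k \<omega> q"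

definition form_eq_on ::
  "'a set \<Rightarrow> ('a, 'e::euclidean_space) chart set \<Rightarrow> nat \<Rightarrow> ('a, 'e) form \<Rightarrow> ('a, 'e) form \<Rightarrow> bool" where
  "form_eq_on S A k \<alpha> \<theta> \<longleftrightarrow> (\<forall>q\<in>S. form_eq (tangent_space A q) k (\<alpha> q) (\<theta> q))"

definition rank_at ::
  "('a, 'e::euclidean_space) chart set \<Rightarrow> ('a, 'e) form \<Rightarrow> 'a \<Rightarrow> nat" where
  "rank_at A \<omega> q = form_rank (tangent_space A q) (\<omega> q)"

end

theory Submission
  imports Defs
begin

text \<open>
  Differentiating \<open>d\<omega> = \<beta> \<and> \<omega>\<close> gives \<open>d\<beta> \<and> \<omega> = 0\<close>; for this the equation must be read in one fixed
  chart on a neighbourhood, so \<open>d\<close> is shown to commute with changes of charts. The rest is pointwise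
  linear algebra. If \<open>\<Omega> \<and> \<Theta> = 0\<close> for \<open>2\<close>-forms with \<open>\<Theta> \<noteq> 0\<close>, the kernel of \<open>\<Omega>\<close> contains the common
  kernel of four linear functionals, and if \<open>\<alpha> \<and> \<Omega> = 0\<close> for a \<open>1\<close>-form \<open>\<alpha> \<noteq> 0\<close>, that of two. A power
  \<open>\<Omega>\<^sup>p\<close> is an alternating form in \<open>2p\<close> arguments that vanishes as soon as one of them lies in the
  kernel of \<open>\<Omega>\<close>. Hence it is \<open>0\<close> when that kernel has codimension less than \<open>2p\<close>, so \<open>\<Omega>\<close> has rank at
  most \<open>2\<close> in the first case and at most \<open>1\<close> in the second. Uniqueness of \<open>\<beta>\<close> on the dense set where
  the rank exceeds \<open>1\<close> extends to the whole manifold by continuity.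
\<close>

section \<open>Kernel and rank of a \<open>2\<close>-form\<close>

text \<open>Forms are taken here on a whole type; a tangent space, which is a set of functions, is
  first carried to the type \<open>'e\<close> by a chart.\<close>

definition multilinear :: "nat \<Rightarrow> ('v::real_vector list \<Rightarrow> real) \<Rightarrow> bool" where
  "multilinear k \<Phi> \<longleftrightarrow> (\<forall>vs i. length vs = k \<longrightarrow> i < k \<longrightarrow> linear (\<lambda>u. \<Phi> (vs[i := u])))"

definition alternating :: "nat \<Rightarrow> ('v::real_vector list \<Rightarrow> real) \<Rightarrow> bool" where
  "alternating k \<Phi> \<longleftrightarrow>
     multilinear k \<Phi> \<and> (\<forall>vs. length vs = k \<longrightarrow> \<not> distinct vs \<longrightarrow> \<Phi> vs = 0)"

text \<open>Allowing \<open>x\<close> in any position lets the condition pass through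
  \<open>wedge\<close> without an appeal to skew-symmetry. For \<open>k = 0\<close> it holds
  vacuously, which starts the induction for wedge powers.\<close>

definition in_kernel :: "nat \<Rightarrow> ('v list \<Rightarrow> real) \<Rightarrow> 'v \<Rightarrow> bool" where
  "in_kernel k \<Phi> x \<longleftrightarrow> (\<forall>vs. length vs = k \<longrightarrow> x \<in> set vs \<longrightarrow> \<Phi> vs = 0)"

section \<open>Vanishing of alternating forms with a large kernel\<close>

text \<open>Gaussian elimination, by induction on the set of equations: an equation with a nonzero
  coefficient eliminates one unknown, which lowers both cardinalities by one.\<close>

lemma homogeneous_system_nontrivial_solution:
  fixes a :: "'i \<Rightarrow> 'j \<Rightarrow> 'f::field"
  assumes "finite I" "finite J" "card I < card J"
  shows "\<exists>c. (\<exists>j\<in>J. c j \<noteq> 0) \<and> (\<forall>i\<in>I. (\<Sum>j\<in>J. a i j * c j) = 0)"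
  using assms
proof (induction I arbitrary: J a rule: finite_induct)
  case empty
  then obtain j where "j \<in> J" by fastforce
  then show ?case by (intro exI[of _ "\<lambda>_. 1"]) auto
next
  case (insert i I)
  show ?case
  proof (cases "\<forall>j\<in>J. a i j = 0")
    case True
    obtain c where "\<exists>j\<in>J. c j \<noteq> 0" "\<forall>i\<in>I. (\<Sum>j\<in>J. a i j * c j) = 0"
      using insert.IH[of J a] insert.prems insert.hyps by auto
    then show ?thesis using True by (intro exI[of _ c]) auto
  next
    case False
    then obtain j0 where j0: "j0 \<in> J" "a i j0 \<noteq> 0" by auto
    let ?J = "J - {j0}"
    \<comment> \<open>The coefficients of the remaining equations after the unknown
      \<open>j0\<close> has been substituted from equation \<open>i\<close>.\<close>
    let ?a = "\<lambda>i' j. a i' j - a i' j0 / a i j0 * a i j"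
    have "card I < card ?J" using insert j0 by simp
    with insert.IH[of ?J ?a] insert.prems
    obtain c where c: "\<exists>j\<in>?J. c j \<noteq> 0" "\<forall>i'\<in>I. (\<Sum>j\<in>?J. ?a i' j * c j) = 0" by auto
    define s where "s = (\<Sum>j\<in>?J. a i j * c j)"
    \<comment> \<open>The value at \<open>j0\<close> is forced by equation \<open>i\<close>.\<close>
    define c' where "c' = c(j0 := - s / a i j0)"
    have split: "(\<Sum>j\<in>J. a i' j * c' j) = (\<Sum>j\<in>?J. a i' j * c j) - a i' j0 * s / a i j0" for i'
    proof -
      have "(\<Sum>j\<in>J. a i' j * c' j) = a i' j0 * c' j0 + (\<Sum>j\<in>?J. a i' j * c' j)"
        using j0 insert.prems by (simp add: sum.remove)
      also have "(\<Sum>j\<in>?J. a i' j * c' j) = (\<Sum>j\<in>?J. a i' j * c j)"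
        by (rule sum.cong) (auto simp: c'_def)
      finally show ?thesis by (simp add: c'_def)
    qed
    have "(\<Sum>j\<in>J. a i j * c' j) = 0"
      using j0 by (simp add: split s_def)
    moreover have "(\<Sum>j\<in>J. a i' j * c' j) = 0" if "i' \<in> I" for i'
    proof -
      have "0 = (\<Sum>j\<in>?J. a i' j * c j - a i' j0 / a i j0 * (a i j * c j))"
        using c(2) that by (simp add: algebra_simps)
      also have "\<dots> = (\<Sum>j\<in>?J. a i' j * c j) - a i' j0 / a i j0 * s"
        by (simp add: sum_subtractf sum_distrib_left s_def)
      finally show ?thesis by (simp add: split)
    qed
    moreover have "\<exists>j\<in>J. c' j \<noteq> 0" using c(1) by (auto simp: c'_def)
    ultimately show ?thesis by (intro exI[of _ c']) auto
  qed
qed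

text \<open>Fewer than \<open>k\<close> linear conditions are met by some combination
  \<open>x\<close> of the \<open>k\<close> vectors in \<open>vs\<close> with coefficients not all
  zero. Putting \<open>x\<close> into a slot \<open>j\<close> with \<open>c j \<noteq> 0\<close>
  gives \<open>0\<close> by the kernel condition, and \<open>c j * \<Phi> vs\<close> by expansion,
  since every other term repeats a vector.\<close>

lemma alternating_vanishes:
  fixes H :: "('v::real_vector \<Rightarrow> real) set"
  assumes alt: "alternating k \<Phi>"
    and H: "finite H" "card H < k"
    and lin: "\<And>h. h \<in> H \<Longrightarrow> linear h"
    and ker: "\<And>x. (\<And>h. h \<in> H \<Longrightarrow> h x = 0) \<Longrightarrow> in_kernel k \<Phi> x"
    and vs: "length vs = k"
  shows "\<Phi> vs = 0"
proof -
  obtain c where c: "\<exists>j<k. c j \<noteq> 0" "\<And>h. h \<in> H \<Longrightarrow> (\<Sum>j<k. h (vs ! j) * c j) = 0"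
    using homogeneous_system_nontrivial_solution[of H "{..<k}" "\<lambda>h j. h (vs ! j)"] H by auto
  define x where "x = (\<Sum>j<k. c j *\<^sub>R vs ! j)"
  have "in_kernel k \<Phi> x"
  proof (rule ker)
    fix h assume h: "h \<in> H"
    show "h x = 0"
      using c(2)[OF h]
      by (simp add: x_def linear_sum[OF lin[OF h]] linear_scale[OF lin[OF h]] mult.commute)
  qed
  obtain j where j: "j < k" "c j \<noteq> 0" using c(1) by auto
  have L: "linear (\<lambda>u. \<Phi> (vs[j := u]))"
    using alt vs j by (simp add: alternating_def multilinear_def)
  have "0 = \<Phi> (vs[j := x])"
    using \<open>in_kernel k \<Phi> x\<close> vs j by (simp add: in_kernel_def set_update_memI)
  also have "\<dots> = (\<Sum>i<k. c i * \<Phi> (vs[j := vs ! i]))"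
    unfolding x_def by (simp add: linear_sum[OF L] linear_scale[OF L])
  also have "\<dots> = (\<Sum>i<k. if i = j then c j * \<Phi> vs else 0)"
  proof (rule sum.cong[OF refl])
    fix i assume i: "i \<in> {..<k}"
    have "\<Phi> (vs[j := vs ! i]) = 0" if "i \<noteq> j"
    proof -
      have "(vs[j := vs ! i]) ! i = (vs[j := vs ! i]) ! j" using that i j vs by simp
      then have "\<not> distinct (vs[j := vs ! i])"
        using that i j vs by (metis length_list_update lessThan_iff nth_eq_iff_index_eq)
      then show ?thesis using alt vs by (simp add: alternating_def)
    qed
    then show "c i * \<Phi> (vs[j := vs ! i]) = (if i = j then c j * \<Phi> vs else 0)" by simp
  qed
  also have "\<dots> = c j * \<Phi> vs" using j by simp
  finally show ?thesis using j by simp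
qed

section \<open>Multilinearity, alternation and kernels of wedge products\<close>

lemma multilinear_wedge:
  fixes \<Omega> \<Theta> :: "'v::real_vector list \<Rightarrow> real"
  assumes "multilinear k \<Omega>" "multilinear l \<Theta>"
  shows "multilinear (k + l) (wedge k l \<Omega> \<Theta>)"
  unfolding multilinear_def
proof (intro allI impI)
  fix vs :: "'v list" and j assume vs: "length vs = k + l" and j: "j < k + l"
  have "linear (\<lambda>u. of_int (sign \<sigma>) * \<Omega> (map (\<lambda>i. vs[j := u] ! \<sigma> i) [0..<k])
                    * \<Theta> (map (\<lambda>i. vs[j := u] ! \<sigma> i) [k..<k + l]))"
    if \<sigma>: "\<sigma> permutes {..<k + l}" for \<sigma>
  proof -
    \<comment> \<open>Each permutation reads slot \<open>j\<close> of the list exactly once, at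
      position \<open>i\<close>, so the varying vector enters exactly one of the two
      factors.\<close>
    define i where "i = inv \<sigma> j"
    have i: "i < k + l" "\<sigma> i = j"
      using \<sigma> j by (auto simp: i_def permutes_inverses permutes_in_image
          dest: permutes_inv permutes_in_image[of _ "{..<k + l}" j])
    have \<sigma>_lt: "\<sigma> m < k + l" if "m < k + l" for m
      using permutes_in_image[OF \<sigma>, of m] that by simp
    have nth_upd: "vs[j := u] ! \<sigma> m = (if m = i then u else vs ! \<sigma> m)" if "m < k + l" for m u
    proof (cases "m = i")
      case False
      then have "\<sigma> m \<noteq> j" using i(2) permutes_inj[OF \<sigma>] by (metis injD)
      then show ?thesis using False by simp
    qed (use i j vs in simp)
    let ?a = "map (\<lambda>i. vs ! \<sigma> i) [0..<k]" and ?b = "map (\<lambda>i. vs ! \<sigma> i) [k..<k + l]"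
    show ?thesis
    proof (cases "i < k")
      case True
      have a: "\<And>u. map (\<lambda>i. vs[j := u] ! \<sigma> i) [0..<k] = ?a[i := u]"
        and b: "\<And>u. map (\<lambda>i. vs[j := u] ! \<sigma> i) [k..<k + l] = ?b"
        using True by (auto intro!: nth_equalityI simp: nth_upd nth_list_update simp del: upt_Suc)
      have "linear (\<lambda>u. \<Omega> (?a[i := u]))"
        using assms(1) True by (simp add: multilinear_def)
      then show ?thesis
        unfolding a b by (simp add: linear_iff algebra_simps)
    next
      case False
      have a: "\<And>u. map (\<lambda>i. vs[j := u] ! \<sigma> i) [0..<k] = ?a"
        and b: "\<And>u. map (\<lambda>i. vs[j := u] ! \<sigma> i) [k..<k + l] = ?b[i - k := u]"
        using False i(1) by (auto intro!: nth_equalityI simp: nth_upd nth_list_update simp del: upt_Suc)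
      have "linear (\<lambda>u. \<Theta> (?b[i - k := u]))"
        using assms(2) False i by (simp add: multilinear_def)
      then show ?thesis
        unfolding a b by (simp add: linear_iff algebra_simps)
    qed
  qed
  then show "linear (\<lambda>u. wedge k l \<Omega> \<Theta> (vs[j := u]))"
    unfolding wedge_def divide_inverse
    by (auto simp: linear_iff sum.distrib algebra_simps sum_distrib_left)
qed

text \<open>Composing with the transposition of two positions with equal entries reverses the sign
  of each summand and changes nothing else, so the sum over all permutations equals its own
  negative.\<close>

lemma wedge_eq_0_of_not_distinct:
  assumes vs: "length vs = k + l" and nd: "\<not> distinct vs"
  shows "wedge k l \<Omega> \<Theta> vs = 0"
proof -
  obtain i j where ij: "i < k + l" "j < k + l" "i \<noteq> j" "vs ! i = vs ! j"
    using nd vs by (auto simp: distinct_conv_nth)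
  let ?S = "{\<sigma>. \<sigma> permutes {..<k + l}}" and ?\<tau> = "Transposition.transpose i j"
  let ?t = "\<lambda>\<sigma>. of_int (sign \<sigma>) * \<Omega> (map (\<lambda>i. vs ! \<sigma> i) [0..<k])
                * \<Theta> (map (\<lambda>i. vs ! \<sigma> i) [k..<k + l])"
  have \<tau>: "?\<tau> permutes {..<k + l}" using ij by (intro permutes_swap_id) auto
  have \<tau>\<tau>: "?\<tau> \<circ> (?\<tau> \<circ> \<sigma>) = \<sigma>" for \<sigma> :: "nat \<Rightarrow> nat"
    by (simp add: fun_eq_iff)
  have "sum ?t ?S = (\<Sum>\<sigma>\<in>?S. ?t (?\<tau> \<circ> \<sigma>))"
    by (rule sum.reindex_bij_witness[where i = "\<lambda>\<sigma>. ?\<tau> \<circ> \<sigma>" and j = "\<lambda>\<sigma>. ?\<tau> \<circ> \<sigma>"])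
      (auto simp: \<tau>\<tau> intro: permutes_compose[OF _ \<tau>])
  also have "\<dots> = (\<Sum>\<sigma>\<in>?S. - ?t \<sigma>)"
  proof (rule sum.cong[OF refl])
    fix \<sigma> assume "\<sigma> \<in> ?S"
    then have "permutation \<sigma>" by (auto simp: permutation_permutes)
    then have "sign (?\<tau> \<circ> \<sigma>) = - sign \<sigma>"
      using ij by (simp add: sign_compose permutation_swap_id sign_swap_id)
    moreover have "vs ! (?\<tau> \<circ> \<sigma>) m = vs ! \<sigma> m" for m
      using ij(4) by (simp add: Transposition.transpose_def)
    ultimately show "?t (?\<tau> \<circ> \<sigma>) = - ?t \<sigma>" by simp
  qed
  finally have "sum ?t ?S = 0" by (simp add: sum_negf)
  then show ?thesis by (simp add: wedge_def)
qed

text \<open>In each summand the entry \<open>x\<close> lands in one of the two factors, which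
  therefore vanishes.\<close>

lemma in_kernel_wedge:
  assumes "in_kernel k \<Omega> x" "in_kernel l \<Theta> x"
  shows "in_kernel (k + l) (wedge k l \<Omega> \<Theta>) x"
  unfolding in_kernel_def
proof (intro allI impI)
  fix vs assume vs: "length vs = k + l" "x \<in> set vs"
  then obtain j where j: "j < k + l" "vs ! j = x" by (auto simp: in_set_conv_nth)
  have "of_int (sign \<sigma>) * \<Omega> (map (\<lambda>i. vs ! \<sigma> i) [0..<k]) * \<Theta> (map (\<lambda>i. vs ! \<sigma> i) [k..<k + l]) = 0"
    if \<sigma>: "\<sigma> permutes {..<k + l}" for \<sigma>
  proof -
    define i where "i = inv \<sigma> j"
    have i: "i < k + l" "\<sigma> i = j"
      using \<sigma> j by (auto simp: i_def permutes_inverses permutes_in_image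
          dest: permutes_inv permutes_in_image[of _ "{..<k + l}" j])
    then consider "x \<in> set (map (\<lambda>i. vs ! \<sigma> i) [0..<k])"
      | "x \<in> set (map (\<lambda>i. vs ! \<sigma> i) [k..<k + l])"
      using j by (cases "i < k") force+
    then show ?thesis using assms by cases (simp_all add: in_kernel_def)
  qed
  then show "wedge k l \<Omega> \<Theta> vs = 0" by (simp add: wedge_def sum.neutral)
qed

lemma alternating_wedge_power:
  assumes "multilinear 2 \<Omega>"
  shows "alternating (2 * p) (wedge_power \<Omega> p)"
proof -
  have "multilinear (2 * p) (wedge_power \<Omega> p)"
  proof (induction p)
    case (Suc p)
    then show ?case using multilinear_wedge[OF assms Suc] by simp
  qed (simp add: multilinear_def)
  \<comment> \<open>For \<open>p = 0\<close> the only list is empty, hence distinct; for larger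
    \<open>p\<close> the power is itself a wedge product.\<close>
  moreover have "wedge_power \<Omega> p vs = 0" if "length vs = 2 * p" "\<not> distinct vs" for vs
    using that by (cases p) (auto simp: wedge_eq_0_of_not_distinct)
  ultimately show ?thesis by (simp add: alternating_def)
qed

lemma in_kernel_wedge_power:
  assumes "in_kernel 2 \<Omega> x"
  shows "in_kernel (2 * p) (wedge_power \<Omega> p) x"
proof (induction p)
  case (Suc p)
  then show ?case using in_kernel_wedge[OF assms Suc] by simp
qed (simp add: in_kernel_def)


lemma wedge_power_eq_0_of_kernel:
  fixes H :: "('v::real_vector \<Rightarrow> real) set"
  assumes "multilinear 2 \<Omega>" "finite H" "card H < 2 * p"
    and "\<And>h. h \<in> H \<Longrightarrow> linear h"
    and "\<And>x. (\<And>h. h \<in> H \<Longrightarrow> h x = 0) \<Longrightarrow> in_kernel 2 \<Omega> x"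
  shows "form_zero UNIV (2 * p) (wedge_power \<Omega> p)"
proof -
  have "wedge_power \<Omega> p vs = 0" if "length vs = 2 * p" for vs
    by (rule alternating_vanishes[OF alternating_wedge_power[OF assms(1)] assms(2,3,4)
          in_kernel_wedge_power[OF assms(5)] that])
  then show ?thesis by (simp add: form_eq_def tuples_def)
qed

section \<open>The rank as the greatest exponent of a nonvanishing power\<close>

lemma multilinear_eq_0_of_mem_0:
  assumes "multilinear k \<Phi>" "length vs = k" "0 \<in> set vs"
  shows "\<Phi> vs = 0"
proof -
  obtain i where i: "i < k" "vs ! i = 0" using assms by (auto simp: in_set_conv_nth)
  then have "linear (\<lambda>u. \<Phi> (vs[i := u]))" using assms by (simp add: multilinear_def)
  from linear_0[OF this] show ?thesis using i by (metis list_update_id)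
qed

text \<open>The coordinate functionals have common kernel \<open>{0}\<close>, so the dimension
  limits the degree of a nonzero power. This bounds the exponents considered in
  \<open>form_rank\<close>, so that \<open>GREATEST\<close> denotes a genuine maximum.\<close>

lemma wedge_power_eq_0_above_dim:
  fixes \<Omega> :: "'e::euclidean_space list \<Rightarrow> real"
  assumes "multilinear 2 \<Omega>" "DIM('e) < 2 * p"
  shows "form_zero UNIV (2 * p) (wedge_power \<Omega> p)"
proof (rule wedge_power_eq_0_of_kernel[where H = "(\<lambda>b x. x \<bullet> b) ` Basis"])
  show "card ((\<lambda>b x. x \<bullet> b) ` (Basis :: 'e set)) < 2 * p"
    using card_image_le[OF finite_Basis, of "\<lambda>b x. x \<bullet> b"] assms(2) by (rule order.strict_trans1)
next
  fix h :: "'e \<Rightarrow> real" assume "h \<in> (\<lambda>b x. x \<bullet> b) ` Basis"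
  then show "linear h"
    by (auto intro: bounded_linear.linear bounded_linear_inner_left)
next
  fix x :: 'e assume "\<And>h. h \<in> (\<lambda>b x. x \<bullet> b) ` Basis \<Longrightarrow> h x = 0"
  then have "x \<bullet> b = 0" if "b \<in> Basis" for b using that by blast
  then have "x = 0" using euclidean_all_zero_iff[of x] by blast
  then show "in_kernel 2 \<Omega> x"
    using multilinear_eq_0_of_mem_0[OF assms(1)] by (simp add: in_kernel_def)
qed (use assms(1) in simp_all)

lemma le_form_rank:
  fixes \<Omega> :: "'e::euclidean_space list \<Rightarrow> real"
  assumes "multilinear 2 \<Omega>" "\<not> form_zero UNIV (2 * p) (wedge_power \<Omega> p)"
  shows "p \<le> form_rank UNIV \<Omega>"
  unfolding form_rank_def
proof (rule Greatest_le_nat[where b = "DIM('e)"])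
  show "y \<le> DIM('e)" if "\<not> form_zero UNIV (2 * y) (wedge_power \<Omega> y)" for y
    using wedge_power_eq_0_above_dim[OF assms(1), of y] that by linarith
qed (use assms(2) in simp)

lemma wedge_power_form_rank:
  fixes \<Omega> :: "'e::euclidean_space list \<Rightarrow> real"
  assumes "multilinear 2 \<Omega>"
  shows "\<not> form_zero UNIV (2 * form_rank UNIV \<Omega>) (wedge_power \<Omega> (form_rank UNIV \<Omega>))"
  unfolding form_rank_def
\<comment> \<open>The power with exponent \<open>0\<close> is the constant \<open>1\<close>, nonzero
  on the empty list, so there is an admissible exponent and the maximum is attained.
  \<open>DIM('e)\<close> is a crude upper bound.\<close>
proof (rule GreatestI_nat[where k = 0 and b = "DIM('e)"])
  show "y \<le> DIM('e)" if "\<not> form_zero UNIV (2 * y) (wedge_power \<Omega> y)" for y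
    using wedge_power_eq_0_above_dim[OF assms(1), of y] that by linarith
qed (simp add: form_eq_def tuples_def)

lemma form_rank_le_of_kernel:
  fixes H :: "('e::euclidean_space \<Rightarrow> real) set"
  assumes "multilinear 2 \<Omega>" "finite H" "card H \<le> 2 * r"
    and "\<And>h. h \<in> H \<Longrightarrow> linear h"
    and "\<And>x. (\<And>h. h \<in> H \<Longrightarrow> h x = 0) \<Longrightarrow> in_kernel 2 \<Omega> x"
  shows "form_rank UNIV \<Omega> \<le> r"
proof (rule ccontr)
  assume "\<not> form_rank UNIV \<Omega> \<le> r"
  then have "card H < 2 * form_rank UNIV \<Omega>" using assms(3) by linarith
  from wedge_power_eq_0_of_kernel[OF assms(1,2) this assms(4,5)] wedge_power_form_rank[OF assms(1)]
  show False by blast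
qed

section \<open>Alternating bilinear maps and wedge products of low degree\<close>

text \<open>The curried form of \<open>alternating 2\<close>, to which the calculus of
  \<open>bilinear\<close> maps applies directly.\<close>

definition alternating_bilinear :: "('v::real_vector \<Rightarrow> 'v \<Rightarrow> real) \<Rightarrow> bool" where
  "alternating_bilinear f \<longleftrightarrow> bilinear f \<and> (\<forall>x. f x x = 0)"

lemma alternating_bilinear_skew:
  assumes "alternating_bilinear f"
  shows "f x y = - f y x"
proof -
  have b: "bilinear f" and z: "\<And>x. f x x = 0" using assms by (auto simp: alternating_bilinear_def)
  have "f (x + y) (x + y) = f x x + f y x + (f x y + f y y)"
    by (simp add: bilinear_ladd[OF b] bilinear_radd[OF b])
  then show ?thesis using z[of "x + y"] z[of x] z[of y] by linarith
qed

lemma alternating_bilinear_of_alternating: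
  assumes "alternating 2 \<Omega>"
  shows "alternating_bilinear (\<lambda>x y. \<Omega> [x, y])"
proof -
  have lin: "linear (\<lambda>u. \<Omega> (vs[i := u]))" if "length vs = 2" "i < 2" for vs i
    using assms that unfolding alternating_def multilinear_def by blast
  have "linear (\<lambda>u. \<Omega> [x, u])" for x using lin[of "[x, undefined]" 1] by simp
  moreover have "linear (\<lambda>u. \<Omega> [u, y])" for y using lin[of "[undefined, y]" 0] by simp
  ultimately have "bilinear (\<lambda>x y. \<Omega> [x, y])" by (simp add: bilinear_def)
  then show ?thesis using assms by (simp add: alternating_bilinear_def alternating_def)
qed

lemma length_2_conv: "length vs = 2 \<longleftrightarrow> (\<exists>x y. vs = [x, y])"
  by (auto simp: length_Suc_conv numeral_2_eq_2)

lemma length_3_conv: "length vs = 3 \<longleftrightarrow> (\<exists>x y z. vs = [x, y, z])"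
  by (auto simp: length_Suc_conv numeral_3_eq_3)

lemma alternating_of_alternating_bilinear:
  assumes "alternating_bilinear (\<lambda>x y. \<Omega> [x, y])"
  shows "alternating 2 \<Omega>"
proof -
  have lin: "linear (\<lambda>u. \<Omega> [x, u])" "linear (\<lambda>u. \<Omega> [u, x])" for x
    using assms unfolding alternating_bilinear_def bilinear_def by blast+
  have "linear (\<lambda>u. \<Omega> (vs[i := u]))" if vs: "length vs = 2" and i: "i < 2" for vs i
  proof -
    obtain x y where "vs = [x, y]" using vs by (auto simp: length_2_conv)
    moreover have "i = 0 \<or> i = 1" using i by linarith
    ultimately show ?thesis using lin by (elim disjE) simp_all
  qed
  moreover have "\<Omega> vs = 0" if vs: "length vs = 2" and nd: "\<not> distinct vs" for vs
  proof -
    obtain x y where "vs = [x, y]" using vs by (auto simp: length_2_conv)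
    then show ?thesis using nd assms by (simp add: alternating_bilinear_def)
  qed
  ultimately show ?thesis by (simp add: alternating_def multilinear_def)
qed

lemma in_kernel_2_iff:
  assumes "alternating 2 \<Omega>"
  shows "in_kernel 2 \<Omega> x \<longleftrightarrow> (\<forall>y. \<Omega> [x, y] = 0)"
proof
  assume "in_kernel 2 \<Omega> x"
  then show "\<forall>y. \<Omega> [x, y] = 0" by (simp add: in_kernel_def)
next
  assume *: "\<forall>y. \<Omega> [x, y] = 0"
  have **: "\<Omega> [y, x] = 0" for y
    using alternating_bilinear_skew[OF alternating_bilinear_of_alternating[OF assms], of y x] * by simp
  have "\<Omega> vs = 0" if vs: "length vs = 2" and x: "x \<in> set vs" for vs
  proof -
    obtain y z where "vs = [y, z]" using vs by (auto simp: length_2_conv)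
    moreover from this x have "x = y \<or> x = z" by simp
    ultimately show ?thesis using * ** by blast
  qed
  then show "in_kernel 2 \<Omega> x" by (simp add: in_kernel_def)
qed

text \<open>By skew-symmetry the six permutations give each of the three terms twice, which the
  divisor \<open>fact 1 * fact 2\<close> compensates.\<close>

lemma wedge_1_2_expand:
  assumes "alternating_bilinear (\<lambda>x y. \<Omega> [x, y])"
  shows "wedge 1 2 \<alpha> \<Omega> [x, y, z] = \<alpha> [x] * \<Omega> [y, z] - \<alpha> [y] * \<Omega> [x, z] + \<alpha> [z] * \<Omega> [x, y]"
proof -
  have S: "{..<1 + 2} = insert 0 (insert 1 {2::nat})" by auto
  have 1: "finite {2::nat}" "(1::nat) \<notin> {2}" and 2: "finite {1, 2::nat}" "(0::nat) \<notin> {1, 2}" by auto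
  note skew = alternating_bilinear_skew[OF assms]
  show ?thesis
    unfolding wedge_def S
    unfolding sum_over_permutations_insert[OF 2] sum_over_permutations_insert[OF 1] permutes_sing
    by (simp add: sign_swap_id permutation_swap_id sign_compose sign_id Transposition.transpose_def
        upt_rec numeral_eq_Suc skew[of y x] skew[of z y] skew[of z x])
qed

text \<open>The two permutations contribute equal terms, and the divisor is \<open>fact 2\<close>.
  Hence a nonzero form has a nonzero first power, which gives rank at least
  \<open>1\<close>.\<close>

lemma wedge_power_1:
  assumes "alternating_bilinear (\<lambda>x y. \<Omega> [x, y])"
  shows "wedge_power \<Omega> 1 [x, y] = \<Omega> [x, y]"
proof -
  have S: "{..<2 + 0} = insert 0 {1::nat}" by auto
  have 1: "finite {1::nat}" "(0::nat) \<notin> {1}" by auto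
  note skew = alternating_bilinear_skew[OF assms]
  have "wedge_power \<Omega> 1 = wedge 2 0 \<Omega> (\<lambda>_. 1)" by simp
  moreover have "wedge 2 0 \<Omega> (\<lambda>_. 1) [x, y] = \<Omega> [x, y]"
    unfolding wedge_def S
    unfolding sum_over_permutations_insert[OF 1] permutes_sing
    by (simp add: sign_swap_id permutation_swap_id sign_compose sign_id Transposition.transpose_def
        upt_rec numeral_eq_Suc skew[of y x])
  ultimately show ?thesis by simp
qed

section \<open>Rank estimates from a vanishing wedge product\<close>

lemma one_le_form_rank:
  fixes \<Omega> :: "'e::euclidean_space list \<Rightarrow> real"
  assumes "alternating 2 \<Omega>" "\<not> form_zero UNIV 2 \<Omega>"
  shows "1 \<le> form_rank UNIV \<Omega>"
proof (rule le_form_rank)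
  obtain x y where "\<Omega> [x, y] \<noteq> 0"
    using assms(2) by (auto simp: form_eq_def tuples_def length_2_conv)
  then have *: "wedge_power \<Omega> 1 [x, y] \<noteq> 0"
    using wedge_power_1[OF alternating_bilinear_of_alternating[OF assms(1)]] by simp
  have "[x, y] \<in> tuples UNIV (2 * 1)" by (simp add: tuples_def)
  with * show "\<not> form_zero UNIV (2 * 1) (wedge_power \<Omega> 1)"
    unfolding form_eq_def by blast
qed (use assms(1) in \<open>simp add: alternating_def\<close>)

text \<open>
  Kernel of \<open>f\<close> when \<open>f \<and> g = 0\<close>: with \<open>g(a, b) = 1\<close>, wedging with \<open>a, b\<close> shows
  \<open>f = - f(a, b) g\<close> off four linear conditions. If some vector \<open>c\<close> satisfying them is not in the
  kernel, complete it to \<open>c, d\<close> and wedge with \<open>c, d\<close>, which yields \<open>f = f(a, b) g\<close> instead.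
\<close>

lemma kernel_of_wedge_eq_0:
  fixes f g :: "'v::real_vector \<Rightarrow> 'v \<Rightarrow> real"
  assumes f: "alternating_bilinear f" and g: "alternating_bilinear g"
    and wedge: "\<And>x y z w. f x y * g z w - f x z * g y w + f x w * g y z
                         + f y z * g x w - f y w * g x z + f z w * g x y = 0"
    and nz: "g a0 b \<noteq> 0"
  shows "\<exists>H :: ('v \<Rightarrow> real) set. finite H \<and> card H \<le> 4 \<and> (\<forall>h\<in>H. linear h) \<and>
             (\<forall>x. (\<forall>h\<in>H. h x = 0) \<longrightarrow> (\<forall>y. f x y = 0))"
proof -
  have bf: "bilinear f" and bg: "bilinear g" and f0: "\<And>x. f x x = 0" and g0: "\<And>x. g x x = 0"
    using f g by (auto simp: alternating_bilinear_def)
  note skf = alternating_bilinear_skew[OF f] and skg = alternating_bilinear_skew[OF g]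
  note lin = bilinear_ladd[OF bf] bilinear_ladd[OF bg] bilinear_lmul[OF bf] bilinear_lmul[OF bg]
    bilinear_lsub[OF bf] bilinear_lsub[OF bg] bilinear_radd[OF bf] bilinear_radd[OF bg]
    bilinear_rmul[OF bf] bilinear_rmul[OF bg] bilinear_rsub[OF bf] bilinear_rsub[OF bg]
  have linear: "linear (\<lambda>x. f x y)" "linear (\<lambda>x. g x y)" for y
    using bf bg by (auto simp: bilinear_def)
  have card4: "card {h1, h2, h3, h4} \<le> 4" for h1 h2 h3 h4 :: "'v \<Rightarrow> real"
    by (simp add: card_insert_if)
  define a where "a = (1 / g a0 b) *\<^sub>R a0"
  have ab: "g a b = 1" using nz by (simp add: a_def lin)
  define l where "l = f a b"
  let ?H = "{\<lambda>x. g x a, \<lambda>x. g x b, \<lambda>x. f x a, \<lambda>x. f x b}"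
  have H: "f x y = - l * g x y" if "g x a = 0" "g x b = 0" "f x a = 0" "f x b = 0" for x y
  proof -
    have "f a x = 0" "f b x = 0" "g a x = 0" "g b x = 0"
      using that skf[of a x] skf[of b x] skg[of a x] skg[of b x] by simp_all
    then show ?thesis using wedge[of a b x y] ab by (simp add: l_def)
  qed
  \<comment> \<open>The same instance of \<open>wedge\<close> collapses for another reason:
    \<open>H\<close> puts all four conditions on \<open>x\<close> and leaves \<open>y\<close> free,
    whereas here both vectors are \<open>g\<close>-orthogonal to \<open>a\<close> and
    \<open>b\<close> and their values under \<open>f\<close> are unrestricted.\<close>
  have W: "f x y = - l * g x y" if "g x a = 0" "g x b = 0" "g y a = 0" "g y b = 0" for x y
  proof -
    have "g a x = 0" "g b x = 0" "g a y = 0" "g b y = 0"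
      using that skg[of a x] skg[of b x] skg[of a y] skg[of b y] by simp_all
    then show ?thesis using wedge[of a b x y] ab by (simp add: l_def)
  qed
  show ?thesis
  proof (cases "\<forall>x. (\<forall>h\<in>?H. h x = 0) \<longrightarrow> (\<forall>y. f x y = 0)")
    case True
    show ?thesis
    proof (intro exI[of _ ?H] conjI)
      show "card ?H \<le> 4" by (rule card4)
      show "\<forall>h\<in>?H. linear h" using linear by blast
      show "\<forall>x. (\<forall>h\<in>?H. h x = 0) \<longrightarrow> (\<forall>y. f x y = 0)" by (rule True)
    qed simp
  next
    case False
    then obtain c d0 where c: "g c a = 0" "g c b = 0" "f c a = 0" "f c b = 0" and cd0: "f c d0 \<noteq> 0"
      by auto
    \<comment> \<open>The components of \<open>d0\<close> along \<open>a\<close> and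
      \<open>b\<close> are removed to make \<open>d\<close> \<open>g\<close>-orthogonal to both.
      Since \<open>f c a = f c b = 0\<close>, this does not affect the value against
      \<open>c\<close>, which the scaling turns into \<open>1\<close>.\<close>
    define d where "d = (1 / f c d0) *\<^sub>R (d0 - g d0 b *\<^sub>R a + g d0 a *\<^sub>R b)"
    have cd: "f c d = 1" using c cd0 by (simp add: d_def lin)
    have d: "g d a = 0" "g d b = 0"
      using ab skg[of b a] by (simp_all add: d_def lin g0)
    \<comment> \<open>So \<open>l \<noteq> 0\<close>, and by \<open>W\<close> the vanishing of
      \<open>f\<close> against \<open>c\<close> and \<open>d\<close> carries over to
      \<open>g\<close>.\<close>
    have lcd: "l * g c d = -1" using H[OF c, of d] cd by simp
    then have l: "l \<noteq> 0" by auto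
    let ?H' = "{\<lambda>x. g x a, \<lambda>x. g x b, \<lambda>x. f x c, \<lambda>x. f x d}"
    have "f x y = 0" if x: "g x a = 0" "g x b = 0" "f x c = 0" "f x d = 0" for x y
    proof -
      have "f x c = - l * g x c" "f x d = - l * g x d" using W x c d by auto
      then have gx: "g x c = 0" "g x d = 0" using x l by auto
      have *: "f x z = l * g x z" for z
      proof -
        have "f c x = 0" "f d x = 0" "g c x = 0" "g d x = 0"
          using x gx skf[of c x] skf[of d x] skg[of c x] skg[of d x] by simp_all
        then have "g x z + f x z * g c d = 0" using wedge[of c d x z] cd by simp
        then have "l * g x z + f x z * (l * g c d) = 0"
          by (metis distrib_left mult.left_commute mult_zero_right)
        then show ?thesis by (simp add: lcd)
      qed
      \<comment> \<open>The relation just found turns \<open>g\<close>-orthogonality to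
        \<open>a\<close> and \<open>b\<close> into \<open>f\<close>-orthogonality, so
        \<open>H\<close> applies to \<open>x\<close> as well, and the two opposite signs force
        \<open>f x y = 0\<close>.\<close>
      have "f x a = 0" "f x b = 0" using *[of a] *[of b] x by simp_all
      then have "f x y = - l * g x y" using H x by blast
      then show ?thesis using *[of y] by simp
    qed
    then have *: "\<forall>x. (\<forall>h\<in>?H'. h x = 0) \<longrightarrow> (\<forall>y. f x y = 0)" by simp
    show ?thesis
    proof (intro exI[of _ ?H'] conjI)
      show "card ?H' \<le> 4" by (rule card4)
      show "\<forall>h\<in>?H'. linear h" using linear by blast
      show "\<forall>x. (\<forall>h\<in>?H'. h x = 0) \<longrightarrow> (\<forall>y. f x y = 0)" by (rule *)
    qed simp
  qed
qed

text \<open>A kernel cut out by four functionals allows rank at most \<open>2\<close>. The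
  hypothesis \<open>wedge\<close> is \<Omega> \<and> \<Theta> = 0 with its six shuffles written out,
  in place of a sum over 24 permutations.\<close>

lemma form_rank_le_2_of_wedge_eq_0:
  fixes \<Omega> \<Theta> :: "'e::euclidean_space list \<Rightarrow> real"
  assumes \<Omega>: "alternating 2 \<Omega>" and \<Theta>: "alternating 2 \<Theta>"
    and wedge: "\<And>x y z w. \<Omega> [x, y] * \<Theta> [z, w] - \<Omega> [x, z] * \<Theta> [y, w] + \<Omega> [x, w] * \<Theta> [y, z]
                         + \<Omega> [y, z] * \<Theta> [x, w] - \<Omega> [y, w] * \<Theta> [x, z] + \<Omega> [z, w] * \<Theta> [x, y] = 0"
    and nz: "\<not> form_zero UNIV 2 \<Theta>"
  shows "form_rank UNIV \<Omega> \<le> 2"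
proof -
  obtain a b where "\<Theta> [a, b] \<noteq> 0"
    using nz by (auto simp: form_eq_def tuples_def length_2_conv)
  from kernel_of_wedge_eq_0[OF alternating_bilinear_of_alternating[OF \<Omega>]
      alternating_bilinear_of_alternating[OF \<Theta>] wedge this]
  obtain H :: "('e \<Rightarrow> real) set" where "finite H" "card H \<le> 4" "\<forall>h\<in>H. linear h"
    "\<forall>x. (\<forall>h\<in>H. h x = 0) \<longrightarrow> (\<forall>y. \<Omega> [x, y] = 0)" by auto
  then show ?thesis
    using \<Omega> by (intro form_rank_le_of_kernel[of _ H]) (auto simp: alternating_def in_kernel_2_iff)
qed

text \<open>With \<open>a0\<close> in the first slot the hypothesis reads \<open>\<alpha> [a0] *
  \<Omega> [x, y] = \<alpha> [x] * \<Omega> [a0, y] - \<alpha> [y] * \<Omega> [a0, x]\<close>, so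
  \<open>x\<close> lies in the kernel as soon as two functionals vanish on it.\<close>

lemma form_rank_le_1_of_wedge_eq_0:
  fixes \<Omega> :: "'e::euclidean_space list \<Rightarrow> real"
  assumes \<Omega>: "alternating 2 \<Omega>" and \<alpha>: "linear (\<lambda>x. \<alpha> [x])"
    and wedge: "\<And>x y z. wedge 1 2 \<alpha> \<Omega> [x, y, z] = 0"
    and nz: "\<alpha> [a0] \<noteq> 0"
  shows "form_rank UNIV \<Omega> \<le> 1"
proof -
  note b\<Omega> = alternating_bilinear_of_alternating[OF \<Omega>]
  have linear\<Omega>: "linear (\<lambda>x. \<Omega> [x, y])" for y
    using b\<Omega> by (auto simp: alternating_bilinear_def bilinear_def)
  let ?H = "{\<lambda>x. \<alpha> [x], \<lambda>x. \<Omega> [x, a0]}"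
  have "\<Omega> [x, y] = 0" if "\<alpha> [x] = 0" "\<Omega> [x, a0] = 0" for x y
    using wedge[of a0 x y] that nz alternating_bilinear_skew[OF b\<Omega>, of a0 x]
    unfolding wedge_1_2_expand[OF b\<Omega>] by simp
  then show ?thesis
    using \<Omega> \<alpha> linear\<Omega>
    by (intro form_rank_le_of_kernel[of _ ?H]) (auto simp: alternating_def in_kernel_2_iff card_insert_if)
qed

section \<open>Pullback and continuity of wedge products\<close>

text \<open>Naturality under pullback by \<open>f\<close>. The length assumption keeps every index
  in range, where \<open>nth\<close> commutes with \<open>map f\<close>.\<close>

lemma wedge_map:
  assumes "length vs = k + l"
  shows "wedge k l (\<lambda>vs. \<Omega> (map f vs)) (\<lambda>vs. \<Theta> (map f vs)) vs = wedge k l \<Omega> \<Theta> (map f vs)"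
proof -
  have 1: "map f (map (\<lambda>i. vs ! \<sigma> i) [0..<k]) = map (\<lambda>i. map f vs ! \<sigma> i) [0..<k]"
    and 2: "map f (map (\<lambda>i. vs ! \<sigma> i) [k..<k + l]) = map (\<lambda>i. map f vs ! \<sigma> i) [k..<k + l]"
    if \<sigma>: "\<sigma> permutes {..<k + l}" for \<sigma>
  proof -
    have "\<sigma> i < length vs" if "i < k + l" for i
      using permutes_in_image[OF \<sigma>, of i] that assms by simp
    then show "map f (map (\<lambda>i. vs ! \<sigma> i) [0..<k]) = map (\<lambda>i. map f vs ! \<sigma> i) [0..<k]"
      and "map f (map (\<lambda>i. vs ! \<sigma> i) [k..<k + l]) = map (\<lambda>i. map f vs ! \<sigma> i) [k..<k + l]"
      by auto
  qed
  show ?thesis unfolding wedge_def by (simp add: 1 2 del: map_map)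
qed

lemma wedge_cong:
  assumes "\<And>vs. length vs = k \<Longrightarrow> \<Omega> vs = \<Omega>' vs" "\<And>vs. length vs = l \<Longrightarrow> \<Theta> vs = \<Theta>' vs"
  shows "wedge k l \<Omega> \<Theta> vs = wedge k l \<Omega>' \<Theta>' vs"
  unfolding wedge_def by (simp add: assms)

lemma wedge_power_map:
  "length vs = 2 * p \<Longrightarrow> wedge_power (\<lambda>vs. \<Omega> (map f vs)) p vs = wedge_power \<Omega> p (map f vs)"
proof (induction p arbitrary: vs)
  case (Suc p)
  have "wedge_power (\<lambda>vs. \<Omega> (map f vs)) (Suc p) vs
      = wedge 2 (2 * p) (\<lambda>vs. \<Omega> (map f vs)) (\<lambda>vs. wedge_power \<Omega> p (map f vs)) vs"
    unfolding wedge_power.simps by (rule wedge_cong[OF refl Suc.IH])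
  also have "\<dots> = wedge_power \<Omega> (Suc p) (map f vs)"
    using Suc.prems wedge_map[of vs 2 "2 * p" \<Omega> f "wedge_power \<Omega> p"] by simp
  finally show ?case .
qed simp

lemma continuous_on_wedge:
  assumes "\<And>vs. length vs = k \<Longrightarrow> continuous_on S (\<lambda>x. \<Omega> x vs)"
    and "\<And>vs. length vs = l \<Longrightarrow> continuous_on S (\<lambda>x. \<Theta> x vs)"
  shows "continuous_on S (\<lambda>x. wedge k l (\<Omega> x) (\<Theta> x) vs)"
  unfolding wedge_def
  by (intro continuous_on_divide continuous_on_sum continuous_on_mult continuous_on_const assms) simp_all

lemma continuous_on_wedge_power:
  assumes "\<And>vs. length vs = 2 \<Longrightarrow> continuous_on S (\<lambda>x. \<Omega> x vs)"
  shows "continuous_on S (\<lambda>x. wedge_power (\<Omega> x) p vs)"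
proof (induction p arbitrary: vs)
  case (Suc p)
  have "continuous_on S (\<lambda>x. wedge 2 (2 * p) (\<Omega> x) (wedge_power (\<Omega> x) p) vs)"
    by (rule continuous_on_wedge[OF assms Suc])
  then show ?case by simp
qed simp

section \<open>Exterior derivatives in a Euclidean space\<close>

lemma has_real_derivative_along_line:
  fixes f :: "'e::real_normed_vector \<Rightarrow> real"
  assumes "(f has_derivative f') (at (p + s *\<^sub>R u))"
  shows "((\<lambda>s. f (p + s *\<^sub>R u)) has_real_derivative f' u) (at s)"
proof -
  have "((\<lambda>s. p + s *\<^sub>R u) has_derivative (\<lambda>h. h *\<^sub>R u)) (at s)"
    by (auto intro!: derivative_eq_intros)
  from diff_chain_at[OF this assms]
  have "((\<lambda>s. f (p + s *\<^sub>R u)) has_derivative (\<lambda>h. f' (h *\<^sub>R u))) (at s)"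
    by (simp add: o_def)
  moreover have "f' (h *\<^sub>R u) = f' u * h" for h
    using linear_scale[OF has_derivative_linear[OF assms], of h u] by simp
  ultimately show ?thesis by (simp add: has_field_derivative_def)
qed

text \<open>The mean value theorem is applied twice: along \<open>u\<close> to the difference of
  \<open>f\<close> on the two sides of the parallelogram parallel to \<open>u\<close>, then along
  \<open>v\<close> to the derivative of \<open>f\<close> in direction \<open>u\<close>.\<close>

lemma second_difference_mvt:
  fixes f :: "'e::real_normed_vector \<Rightarrow> real"
  assumes f: "\<And>y. y \<in> S \<Longrightarrow> (f has_derivative f' y) (at y)"
    and g: "\<And>y. y \<in> S \<Longrightarrow> ((\<lambda>y. f' y u) has_derivative g y) (at y)"
    and t: "t > 0"
    and S: "\<And>a b. 0 \<le> a \<Longrightarrow> a \<le> t \<Longrightarrow> 0 \<le> b \<Longrightarrow> b \<le> t \<Longrightarrow> x + a *\<^sub>R u + b *\<^sub>R v \<in> S"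
  shows "\<exists>a b. 0 \<le> a \<and> a \<le> t \<and> 0 \<le> b \<and> b \<le> t \<and>
    f (x + t *\<^sub>R u + t *\<^sub>R v) - f (x + t *\<^sub>R u) - f (x + t *\<^sub>R v) + f x
      = t * t * g (x + a *\<^sub>R u + b *\<^sub>R v) v"
proof -
  define h where "h s = f ((x + t *\<^sub>R v) + s *\<^sub>R u) - f (x + s *\<^sub>R u)" for s
  have "(h has_real_derivative f' ((x + t *\<^sub>R v) + s *\<^sub>R u) u - f' (x + s *\<^sub>R u) u) (at s)"
    if "0 \<le> s" "s \<le> t" for s
    unfolding h_def
    using f[OF S[of s t]] f[OF S[of s 0]] that t
    by (intro DERIV_diff has_real_derivative_along_line) (simp_all add: algebra_simps)
  from MVT2[OF t this] obtain a where a: "0 < a" "a < t"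
    "h t - h 0 = t * (f' ((x + t *\<^sub>R v) + a *\<^sub>R u) u - f' (x + a *\<^sub>R u) u)" by auto
  have "((\<lambda>s. f' ((x + a *\<^sub>R u) + s *\<^sub>R v) u) has_real_derivative
          g ((x + a *\<^sub>R u) + s *\<^sub>R v) v) (at s)" if "0 \<le> s" "s \<le> t" for s
    using a that by (intro has_real_derivative_along_line g S) auto
  from MVT2[OF t this] obtain b where b: "0 < b" "b < t"
    "f' ((x + a *\<^sub>R u) + t *\<^sub>R v) u - f' (x + a *\<^sub>R u) u = t * g (x + a *\<^sub>R u + b *\<^sub>R v) v"
    by auto
  have "h t - h 0 = t * (t * g (x + a *\<^sub>R u + b *\<^sub>R v) v)"
    using a(3) b(3) by (simp add: algebra_simps)
  then show ?thesis using a b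
    by (intro exI[of _ a] exI[of _ b]) (simp add: h_def algebra_simps)
qed

text \<open>The second difference over a parallelogram is symmetric in \<open>u\<close> and
  \<open>v\<close>, so a small parallelogram yields a value of \<open>g\<close> and a value of
  \<open>h\<close> near \<open>x\<close> that agree; continuity carries the equality to
  \<open>x\<close>.\<close>

lemma second_derivative_symmetric_real:
  fixes f :: "'e::real_normed_vector \<Rightarrow> real"
  assumes S: "open S" "x \<in> S"
    and f: "\<And>y. y \<in> S \<Longrightarrow> (f has_derivative f' y) (at y)"
    and g: "\<And>y. y \<in> S \<Longrightarrow> ((\<lambda>y. f' y u) has_derivative g y) (at y)"
    and h: "\<And>y. y \<in> S \<Longrightarrow> ((\<lambda>y. f' y v) has_derivative h y) (at y)"
    and cont: "continuous_on S (\<lambda>y. g y v)" "continuous_on S (\<lambda>y. h y u)"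
  shows "g x v = h x u"
proof (rule ccontr)
  assume ne: "g x v \<noteq> h x u"
  \<comment> \<open>Half the gap: the open balls of radius \<open>e\<close> about the two values are
    disjoint.\<close>
  define e where "e = \<bar>g x v - h x u\<bar> / 2"
  have e: "e > 0" using ne by (simp add: e_def)
  obtain d1 where d1: "d1 > 0" "\<And>y. y \<in> S \<Longrightarrow> dist y x < d1 \<Longrightarrow> dist (g y v) (g x v) < e"
    using cont(1) S e unfolding continuous_on_iff by metis
  obtain d2 where d2: "d2 > 0" "\<And>y. y \<in> S \<Longrightarrow> dist y x < d2 \<Longrightarrow> dist (h y u) (h x u) < e"
    using cont(2) S e unfolding continuous_on_iff by metis
  obtain d3 where d3: "d3 > 0" "ball x d3 \<subseteq> S" using S openE by blast
  define d where "d = min d1 (min d2 d3)"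
  have d: "d > 0" "d \<le> d1" "d \<le> d2" "d \<le> d3" using d1 d2 d3 by (auto simp: d_def)
  \<comment> \<open>Small enough for the whole parallelogram to stay within \<open>d / 2\<close> of
    \<open>x\<close>; the summand \<open>1\<close> keeps the denominator positive when
    \<open>u\<close> and \<open>v\<close> vanish.\<close>
  define t where "t = d / (2 * (norm u + norm v + 1))"
  have pos: "norm u + norm v + 1 > 0" by (smt (verit) norm_ge_zero)
  have t: "t > 0" using d pos by (simp add: t_def)
  have near: "dist (x + a *\<^sub>R u + b *\<^sub>R v) x < d"
    if "0 \<le> a" "a \<le> t" "0 \<le> b" "b \<le> t" for a b
  proof -
    have "dist (x + a *\<^sub>R u + b *\<^sub>R v) x = norm (a *\<^sub>R u + b *\<^sub>R v)"
      by (simp add: dist_norm algebra_simps)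
    also have "\<dots> \<le> a * norm u + b * norm v"
      using norm_triangle_ineq[of "a *\<^sub>R u" "b *\<^sub>R v"] that by simp
    also have "\<dots> \<le> t * norm u + t * norm v"
      using that by (intro add_mono mult_right_mono) auto
    also have "\<dots> \<le> t * (norm u + norm v + 1)" using t by (simp add: algebra_simps)
    also have "\<dots> = d / 2" using pos unfolding t_def by (simp add: divide_simps)
    finally show ?thesis using d by linarith
  qed
  then have inS: "x + a *\<^sub>R u + b *\<^sub>R v \<in> S"
    if "0 \<le> a" "a \<le> t" "0 \<le> b" "b \<le> t" for a b
    using that d d3 by (force simp: dist_commute)
  have inS': "x + a *\<^sub>R v + b *\<^sub>R u \<in> S"
    if "0 \<le> a" "a \<le> t" "0 \<le> b" "b \<le> t" for a b
    using inS[of b a] that by (simp add: algebra_simps)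
  obtain a b where ab: "0 \<le> a" "a \<le> t" "0 \<le> b" "b \<le> t"
    and 1: "f (x + t *\<^sub>R u + t *\<^sub>R v) - f (x + t *\<^sub>R u) - f (x + t *\<^sub>R v) + f x
      = t * t * g (x + a *\<^sub>R u + b *\<^sub>R v) v"
    using second_difference_mvt[OF f g t inS] by blast
  obtain a' b' where ab': "0 \<le> a'" "a' \<le> t" "0 \<le> b'" "b' \<le> t"
    and 2: "f (x + t *\<^sub>R v + t *\<^sub>R u) - f (x + t *\<^sub>R v) - f (x + t *\<^sub>R u) + f x
      = t * t * h (x + a' *\<^sub>R v + b' *\<^sub>R u) u"
    using second_difference_mvt[OF f h t inS'] by blast
  have "x + t *\<^sub>R v + t *\<^sub>R u = x + t *\<^sub>R u + t *\<^sub>R v" by (simp add: algebra_simps)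
  with 1 2 have tt: "t * t * g (x + a *\<^sub>R u + b *\<^sub>R v) v = t * t * h (x + a' *\<^sub>R v + b' *\<^sub>R u) u"
    by (smt (verit))
  from tt have eq: "g (x + a *\<^sub>R u + b *\<^sub>R v) v = h (x + a' *\<^sub>R v + b' *\<^sub>R u) u" using t by simp
  have "dist (g (x + a *\<^sub>R u + b *\<^sub>R v) v) (g x v) < e"
    using d1(2)[OF inS[OF ab]] near[OF ab] d by linarith
  moreover have "dist (h (x + a' *\<^sub>R v + b' *\<^sub>R u) u) (h x u) < e"
    using d2(2)[OF inS'[OF ab']] near[of b' a'] ab' d by (simp add: algebra_simps)
  ultimately show False
    unfolding eq dist_real_def e_def by (simp add: abs_if split: if_splits)
qed

lemma second_derivative_symmetric:
  fixes f :: "'e::real_normed_vector \<Rightarrow> 'f::euclidean_space"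
  assumes S: "open S" "x \<in> S"
    and f: "\<And>y. y \<in> S \<Longrightarrow> (f has_derivative f' y) (at y)"
    and g: "\<And>y. y \<in> S \<Longrightarrow> ((\<lambda>y. f' y u) has_derivative g y) (at y)"
    and h: "\<And>y. y \<in> S \<Longrightarrow> ((\<lambda>y. f' y v) has_derivative h y) (at y)"
    and cont: "continuous_on S (\<lambda>y. g y v)" "continuous_on S (\<lambda>y. h y u)"
  shows "g x v = h x u"
proof (rule euclidean_eqI)
  fix b :: 'f assume "b \<in> Basis"
  show "g x v \<bullet> b = h x u \<bullet> b"
    by (rule second_derivative_symmetric_real[OF S has_derivative_inner_left[OF f]
          has_derivative_inner_left[OF g] has_derivative_inner_left[OF h]
          continuous_on_inner[OF cont(1) continuous_on_const]
          continuous_on_inner[OF cont(2) continuous_on_const]])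
qed

lemma smooth_on_imp_continuous_on: "smooth_on f S \<Longrightarrow> continuous_on S f"
  unfolding smooth_on_def by (metis Ck_on.simps(1))

lemma smooth_on_imp_has_derivative:
  assumes "smooth_on f S" "x \<in> S"
  shows "(f has_derivative frechet_derivative f (at x)) (at x)"
  using assms unfolding smooth_on_def by (metis Ck_on.simps(2) frechet_derivative_works)

lemma smooth_on_frechet_derivative:
  assumes "smooth_on f S"
  shows "smooth_on (\<lambda>x. frechet_derivative f (at x) v) S"
  using assms unfolding smooth_on_def by (metis Ck_on.simps(2))

lemma smooth_on_second_derivative_symmetric:
  fixes f :: "'e::real_normed_vector \<Rightarrow> 'f::euclidean_space"
  assumes f: "smooth_on f S" and S: "open S" "x \<in> S"
  shows "frechet_derivative (\<lambda>y. frechet_derivative f (at y) u) (at x) v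
       = frechet_derivative (\<lambda>y. frechet_derivative f (at y) v) (at x) u"
proof -
  note d1 = smooth_on_frechet_derivative[OF f]
  show ?thesis
    by (rule second_derivative_symmetric[OF S smooth_on_imp_has_derivative[OF f]
          smooth_on_imp_has_derivative[OF d1] smooth_on_imp_has_derivative[OF d1]
          smooth_on_imp_continuous_on[OF smooth_on_frechet_derivative[OF d1]]
          smooth_on_imp_continuous_on[OF smooth_on_frechet_derivative[OF d1]]])
qed

section \<open>Pullback and the equation \<open>dW = B \<and> W\<close> in a Euclidean space\<close>

lemma bilinear_expand:
  fixes f :: "'e::euclidean_space \<Rightarrow> 'e \<Rightarrow> real"
  assumes "bilinear f"
  shows "f a b = (\<Sum>i\<in>Basis. \<Sum>j\<in>Basis. (a \<bullet> i) * (b \<bullet> j) * f i j)"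
proof -
  have l: "linear (\<lambda>x. f x y)" "linear (f x)" for x y using assms by (auto simp: bilinear_def)
  have "f a b = f (\<Sum>i\<in>Basis. (a \<bullet> i) *\<^sub>R i) (\<Sum>j\<in>Basis. (b \<bullet> j) *\<^sub>R j)"
    by (simp only: euclidean_representation)
  also have "\<dots> = (\<Sum>i\<in>Basis. (a \<bullet> i) * f i (\<Sum>j\<in>Basis. (b \<bullet> j) *\<^sub>R j))"
    by (simp add: linear_sum[OF l(1)] linear_scale[OF l(1)])
  also have "\<dots> = (\<Sum>i\<in>Basis. (a \<bullet> i) * (\<Sum>j\<in>Basis. (b \<bullet> j) * f i j))"
    by (simp only: linear_sum[OF l(2)] linear_scale[OF l(2)] real_scaleR_def)
  finally show ?thesis by (simp add: sum_distrib_left mult.assoc)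
qed

text \<open>The product rule when differentiability of \<open>W\<close> is given for fixed
  arguments: expansion in a basis turns the expression into a finite sum of products of real
  functions.\<close>

lemma has_derivative_bilinear_family:
  fixes W :: "'e::euclidean_space \<Rightarrow> 'e \<Rightarrow> 'e \<Rightarrow> real" and \<phi> A B :: "'d::real_normed_vector \<Rightarrow> 'e"
  assumes T: "open T" "x \<in> T" and U: "open U" "\<phi> ` T \<subseteq> U"
    and W: "\<And>y. y \<in> U \<Longrightarrow> bilinear (W y)"
    and D: "\<And>a b. ((\<lambda>y. W y a b) has_derivative D a b) (at (\<phi> x))"
    and \<phi>: "(\<phi> has_derivative \<phi>') (at x)"
    and A: "(A has_derivative A') (at x)" and B: "(B has_derivative B') (at x)"
  shows "((\<lambda>x. W (\<phi> x) (A x) (B x)) has_derivative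
          (\<lambda>h. D (A x) (B x) (\<phi>' h) + W (\<phi> x) (A' h) (B x) + W (\<phi> x) (A x) (B' h))) (at x)"
proof -
  have \<phi>x: "\<phi> x \<in> U" using T U by auto
  have "((\<lambda>y. \<Sum>i\<in>Basis. \<Sum>j\<in>Basis. (a \<bullet> i) * (b \<bullet> j) * W y i j) has_derivative
          (\<lambda>h. \<Sum>i\<in>Basis. \<Sum>j\<in>Basis. (a \<bullet> i) * (b \<bullet> j) * D i j h)) (at (\<phi> x))" for a b
    by (intro has_derivative_sum has_derivative_mult_right D)
  then have "((\<lambda>y. W y a b) has_derivative
          (\<lambda>h. \<Sum>i\<in>Basis. \<Sum>j\<in>Basis. (a \<bullet> i) * (b \<bullet> j) * D i j h)) (at (\<phi> x))" for a b
    by (rule has_derivative_transform_within_open[OF _ U(1) \<phi>x]) (simp add: bilinear_expand[OF W, of _ a b])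
  \<comment> \<open>So \<open>D a b\<close> is itself bilinear in \<open>a\<close> and
    \<open>b\<close>, which reassembles the first term of the derivative at the end.\<close>
  then have D_expand: "D a b = (\<lambda>h. \<Sum>i\<in>Basis. \<Sum>j\<in>Basis. (a \<bullet> i) * (b \<bullet> j) * D i j h)" for a b
    using has_derivative_unique[OF D] by blast
  have W\<phi>: "((\<lambda>x. W (\<phi> x) i j) has_derivative (\<lambda>h. D i j (\<phi>' h))) (at x)" for i j
    using diff_chain_at[OF \<phi> D] by (simp add: o_def)
  have "((\<lambda>x. \<Sum>i\<in>Basis. \<Sum>j\<in>Basis. ((A x \<bullet> i) * (B x \<bullet> j)) * W (\<phi> x) i j) has_derivative
      (\<lambda>h. \<Sum>i\<in>Basis. \<Sum>j\<in>Basis. ((A x \<bullet> i) * (B x \<bullet> j)) * D i j (\<phi>' h)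
             + ((A x \<bullet> i) * (B' h \<bullet> j) + (A' h \<bullet> i) * (B x \<bullet> j)) * W (\<phi> x) i j)) (at x)"
    by (intro has_derivative_sum has_derivative_mult W\<phi> has_derivative_inner_left A B)
  then have "((\<lambda>x. W (\<phi> x) (A x) (B x)) has_derivative
      (\<lambda>h. \<Sum>i\<in>Basis. \<Sum>j\<in>Basis. ((A x \<bullet> i) * (B x \<bullet> j)) * D i j (\<phi>' h)
             + ((A x \<bullet> i) * (B' h \<bullet> j) + (A' h \<bullet> i) * (B x \<bullet> j)) * W (\<phi> x) i j)) (at x)"
  proof (rule has_derivative_transform_within_open[OF _ T])
    fix z assume "z \<in> T"
    then have "bilinear (W (\<phi> z))" using U W by blast
    from bilinear_expand[OF this, of "A z" "B z"]
    show "(\<Sum>i\<in>Basis. \<Sum>j\<in>Basis. ((A z \<bullet> i) * (B z \<bullet> j)) * W (\<phi> z) i j) = W (\<phi> z) (A z) (B z)"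
      by simp
  qed
  moreover have "(\<Sum>i\<in>Basis. \<Sum>j\<in>Basis. ((A x \<bullet> i) * (B x \<bullet> j)) * D i j (\<phi>' h)
             + ((A x \<bullet> i) * (B' h \<bullet> j) + (A' h \<bullet> i) * (B x \<bullet> j)) * W (\<phi> x) i j)
        = D (A x) (B x) (\<phi>' h) + W (\<phi> x) (A' h) (B x) + W (\<phi> x) (A x) (B' h)" for h
    unfolding D_expand[of "A x" "B x"] bilinear_expand[OF W[OF \<phi>x], of "A' h" "B x"]
      bilinear_expand[OF W[OF \<phi>x], of "A x" "B' h"]
    by (simp add: sum.distrib distrib_right)
  ultimately show ?thesis by (simp only:)
qed

text \<open>The exterior derivative commutes with pullback, \<open>V\<close> being the pullback of
  \<open>W\<close> by \<phi>. Besides the wanted terms, differentiation leaves terms with second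
  derivatives of \<phi>; these cancel by the symmetry of second derivatives and the skew-symmetry of
  \<open>W\<close>.\<close>

lemma exterior_derivative_pullback:
  fixes W :: "'e::euclidean_space \<Rightarrow> 'e \<Rightarrow> 'e \<Rightarrow> real" and \<phi> :: "'d::euclidean_space \<Rightarrow> 'e"
  assumes T: "open T" "x \<in> T" and U: "open U" "\<phi> ` T \<subseteq> U"
    and W: "\<And>y. y \<in> U \<Longrightarrow> alternating_bilinear (W y)"
    and D: "\<And>a b. ((\<lambda>y. W y a b) has_derivative D a b) (at (\<phi> x))"
    and \<phi>: "smooth_on \<phi> T"
    and V: "\<And>y a b. y \<in> T \<Longrightarrow>
              V y a b = W (\<phi> y) (frechet_derivative \<phi> (at y) a) (frechet_derivative \<phi> (at y) b)"
  shows "frechet_derivative (\<lambda>y. V y b c) (at x) a - frechet_derivative (\<lambda>y. V y a c) (at x) b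
         + frechet_derivative (\<lambda>y. V y a b) (at x) c
       = D (frechet_derivative \<phi> (at x) b) (frechet_derivative \<phi> (at x) c) (frechet_derivative \<phi> (at x) a)
       - D (frechet_derivative \<phi> (at x) a) (frechet_derivative \<phi> (at x) c) (frechet_derivative \<phi> (at x) b)
       + D (frechet_derivative \<phi> (at x) a) (frechet_derivative \<phi> (at x) b) (frechet_derivative \<phi> (at x) c)"
proof -
  let ?d = "frechet_derivative \<phi> (at x)"
  let ?dd = "\<lambda>u. frechet_derivative (\<lambda>y. frechet_derivative \<phi> (at y) u) (at x)"
  have bil: "bilinear (W y)" if "y \<in> U" for y using W[OF that] by (simp add: alternating_bilinear_def)
  have "((\<lambda>y. W (\<phi> y) (frechet_derivative \<phi> (at y) u) (frechet_derivative \<phi> (at y) v)) has_derivative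
        (\<lambda>h. D (?d u) (?d v) (?d h) + W (\<phi> x) (?dd u h) (?d v) + W (\<phi> x) (?d u) (?dd v h))) (at x)"
    for u v
    by (rule has_derivative_bilinear_family[OF T U bil D])
      (use T smooth_on_imp_has_derivative[OF \<phi>] smooth_on_imp_has_derivative[OF smooth_on_frechet_derivative[OF \<phi>]]
       in auto)
  then have dV: "((\<lambda>y. V y u v) has_derivative
        (\<lambda>h. D (?d u) (?d v) (?d h) + W (\<phi> x) (?dd u h) (?d v) + W (\<phi> x) (?d u) (?dd v h))) (at x)"
    for u v
    by (rule has_derivative_transform_within_open[OF _ T]) (simp add: V)
  then have V': "frechet_derivative (\<lambda>y. V y u v) (at x) h =
        D (?d u) (?d v) (?d h) + W (\<phi> x) (?dd u h) (?d v) + W (\<phi> x) (?d u) (?dd v h)" for u v h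
    by (simp only: frechet_derivative_at[OF dV, symmetric])
  have sym: "?dd u v = ?dd v u" for u v
    by (rule smooth_on_second_derivative_symmetric[OF \<phi> T])
  have "\<phi> x \<in> U" using T U by auto
  note skew = alternating_bilinear_skew[OF W[OF this]]
  show ?thesis
    unfolding V' using skew[of "?d a" "?dd b c"] skew[of "?d b" "?dd a c"] skew[of "?dd a b" "?d c"]
    by (simp add: sym[of b a] sym[of c a] sym[of c b])
qed

text \<open>
  The derivative of \<open>dW = B \<and> W\<close>, alternated over four directions: second derivatives of \<open>W\<close> cancel.
\<close>

lemma alternated_derivative_of_wedge:
  fixes W B1 :: "'i \<Rightarrow> 'i \<Rightarrow> real" and B :: "'i \<Rightarrow> real"
  assumes sym: "\<And>a b c d. W2 a b c d = W2 a b d c"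
    and diff: "\<And>a b c d. W2 b c a d - W2 a c b d + W2 a b c d
      = (B a * W1 b c d + B1 a d * W b c) - (B b * W1 a c d + B1 b d * W a c)
        + (B c * W1 a b d + B1 c d * W a b)"
    and dW: "\<And>a b c. W1 b c a - W1 a c b + W1 a b c = B a * W b c - B b * W a c + B c * W a b"
  shows "W a b * (B1 d c - B1 c d) - W a c * (B1 d b - B1 b d) + W a d * (B1 c b - B1 b c)
       + W b c * (B1 d a - B1 a d) - W b d * (B1 c a - B1 a c) + W c d * (B1 b a - B1 a b) = 0"
proof -
  \<comment> \<open>First derivatives of \<open>W\<close> remain in the combination B \<and> dW,
    which \<open>dW\<close> turns into B \<and> B \<and> W = 0.\<close>
  have mult: "s * (W1 b c a - W1 a c b + W1 a b c) = s * (B a * W b c - B b * W a c + B c * W a b)"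
    for s a b c by (simp add: dW)
  \<comment> \<open>Each instance of \<open>diff\<close> differentiates the equation for three of
    the four vectors in the direction of the omitted one.\<close>
  show ?thesis
    using diff[where a = b and b = c and c = d and d = a]
      diff[where a = a and b = c and c = d and d = b]
      diff[where a = a and b = b and c = d and d = c]
      diff[where a = a and b = b and c = c and d = d]
      mult[where s = "B a" and a = b and b = c and c = d]
      mult[where s = "B b" and a = a and b = c and c = d]
      mult[where s = "B c" and a = a and b = b and c = d]
      mult[where s = "B d" and a = a and b = b and c = c]
      sym[of c d a b] sym[of b d a c] sym[of b c a d] sym[of a d b c] sym[of a c b d] sym[of a b c d]
    by (simp add: algebra_simps)
qed

text \<open>The identity \<open>0 = d(dW) = d(b \<and> W) = db \<and> W - b \<and> dW = db \<and> W\<close> in coordinates.\<close>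

lemma wedge_exterior_derivative_eq_0:
  fixes W :: "'e::euclidean_space \<Rightarrow> 'e \<Rightarrow> 'e \<Rightarrow> real" and B :: "'e \<Rightarrow> 'e \<Rightarrow> real"
  assumes U: "open U" "x \<in> U"
    and W: "\<And>a b. smooth_on (\<lambda>y. W y a b) U"
    and B: "\<And>a. smooth_on (\<lambda>y. B y a) U"
    and dW: "\<And>y a b c. y \<in> U \<Longrightarrow>
        frechet_derivative (\<lambda>y. W y b c) (at y) a - frechet_derivative (\<lambda>y. W y a c) (at y) b
         + frechet_derivative (\<lambda>y. W y a b) (at y) c
        = B y a * W y b c - B y b * W y a c + B y c * W y a b"
    and E: "\<And>a b. E a b = frechet_derivative (\<lambda>y. B y b) (at x) a - frechet_derivative (\<lambda>y. B y a) (at x) b"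
  shows "W x a b * E c d - W x a c * E b d + W x a d * E b c
       + W x b c * E a d - W x b d * E a c + W x c d * E a b = 0"
proof -
  let ?W1 = "\<lambda>a b y c. frechet_derivative (\<lambda>y. W y a b) (at y) c"
  let ?W2 = "\<lambda>a b c d. frechet_derivative (\<lambda>y. ?W1 a b y c) (at x) d"
  let ?B1 = "\<lambda>a c. frechet_derivative (\<lambda>y. B y a) (at x) c"
  have W1: "((\<lambda>y. W y a b) has_derivative ?W1 a b x) (at x)" for a b
    using smooth_on_imp_has_derivative[OF W U(2)] .
  have W2: "((\<lambda>y. ?W1 a b y c) has_derivative ?W2 a b c) (at x)" for a b c
    using smooth_on_imp_has_derivative[OF smooth_on_frechet_derivative[OF W] U(2)] .
  have B1: "((\<lambda>y. B y a) has_derivative ?B1 a) (at x)" for a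
    using smooth_on_imp_has_derivative[OF B U(2)] .
  have sym: "?W2 a b c d = ?W2 a b d c" for a b c d
    by (rule smooth_on_second_derivative_symmetric[OF W U])
  have diff: "?W2 b c a d - ?W2 a c b d + ?W2 a b c d
      = (B x a * ?W1 b c x d + ?B1 a d * W x b c) - (B x b * ?W1 a c x d + ?B1 b d * W x a c)
        + (B x c * ?W1 a b x d + ?B1 c d * W x a b)" for a b c d
  proof -
    \<comment> \<open>The equation \<open>dW\<close> holds throughout the open set \<open>U\<close>,
      so its two sides have the same derivative at \<open>x\<close>.\<close>
    have 1: "((\<lambda>y. ?W1 b c y a - ?W1 a c y b + ?W1 a b y c) has_derivative
        (\<lambda>d. ?W2 b c a d - ?W2 a c b d + ?W2 a b c d)) (at x)"
      by (intro has_derivative_add has_derivative_diff W2)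
    have "((\<lambda>y. B y a * W y b c - B y b * W y a c + B y c * W y a b) has_derivative
        (\<lambda>d. (B x a * ?W1 b c x d + ?B1 a d * W x b c) - (B x b * ?W1 a c x d + ?B1 b d * W x a c)
        + (B x c * ?W1 a b x d + ?B1 c d * W x a b))) (at x)"
      by (intro has_derivative_add has_derivative_diff has_derivative_mult W1 B1)
    then have "((\<lambda>y. ?W1 b c y a - ?W1 a c y b + ?W1 a b y c) has_derivative
        (\<lambda>d. (B x a * ?W1 b c x d + ?B1 a d * W x b c) - (B x b * ?W1 a c x d + ?B1 b d * W x a c)
        + (B x c * ?W1 a b x d + ?B1 c d * W x a b))) (at x)"
      by (rule has_derivative_transform_within_open[OF _ U]) (simp add: dW)
    from has_derivative_unique[OF 1 this] show ?thesis by metis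
  qed
  show ?thesis
    unfolding E
    by (rule alternated_derivative_of_wedge[of ?W2 "B x" "\<lambda>a b. ?W1 a b x" ?B1 "W x", OF sym diff dW[OF U(2)]])
qed

section \<open>Coordinates on a manifold\<close>

locale manifold =
  fixes X :: "'a topology" and A :: "('a, 'e::euclidean_space) chart set"
  assumes smooth_manifold: "smooth_manifold X A"
begin

abbreviation chart_image :: "('a, 'e) chart \<Rightarrow> 'e set" where
  "chart_image c \<equiv> snd c ` fst c"

abbreviation overlap :: "('a, 'e) chart \<Rightarrow> ('a, 'e) chart \<Rightarrow> 'e set" where
  "overlap c c' \<equiv> snd c ` (fst c \<inter> fst c')"

abbreviation jacobian :: "('a, 'e) chart \<Rightarrow> ('a, 'e) chart \<Rightarrow> 'a \<Rightarrow> 'e \<Rightarrow> 'e" where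
  "jacobian c c' q \<equiv> frechet_derivative (transition c c') (at (snd c q))"

section \<open>Charts and transition maps\<close>

lemma chart:
  assumes "c \<in> A"
  shows openin_chart_domain: "openin X (fst c)"
    and open_chart_image: "open (chart_image c)"
    and homeomorphic_chart: "homeomorphic_map (subtopology X (fst c)) (top_of_set (chart_image c)) (snd c)"
  using smooth_manifold assms by (auto simp: smooth_manifold_def is_chart_def)

lemma topspace_chart_domain: "c \<in> A \<Longrightarrow> topspace (subtopology X (fst c)) = fst c"
  by (rule topspace_subtopology_subset[OF openin_subset[OF openin_chart_domain]])

lemma inj_on_chart: "c \<in> A \<Longrightarrow> inj_on (snd c) (fst c)"
  using homeomorphic_imp_injective_map[OF homeomorphic_chart] by (simp only: topspace_chart_domain)

lemma inv_chart [simp]: "c \<in> A \<Longrightarrow> q \<in> fst c \<Longrightarrow> inv_into (fst c) (snd c) (snd c q) = q"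
  using inj_on_chart by (simp add: inv_into_f_f)

lemma transition_chart: "c \<in> A \<Longrightarrow> q \<in> fst c \<Longrightarrow> transition c c' (snd c q) = snd c' q"
  by (simp add: transition_def)

lemma open_chart_image_of_openin:
  assumes c: "c \<in> A" and V: "openin X V" "V \<subseteq> fst c"
  shows "open (snd c ` V)"
proof -
  have "openin (subtopology X (fst c)) V"
    using V openin_open_subtopology[OF openin_chart_domain[OF c]] by blast
  then have "openin (top_of_set (chart_image c)) (snd c ` V)"
    using homeomorphic_imp_open_map[OF homeomorphic_chart[OF c]] by (simp add: open_map_def)
  then show ?thesis using openin_open_eq[OF open_chart_image[OF c]] by blast
qed

lemma openin_chart_preimage:
  assumes c: "c \<in> A" and W: "open W"
  shows "openin X {q \<in> fst c. snd c q \<in> W}"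
proof -
  have "openin (top_of_set (chart_image c)) (chart_image c \<inter> W)"
    using W by (rule openin_open_Int)
  from openin_continuous_map_preimage[OF homeomorphic_imp_continuous_map[OF homeomorphic_chart[OF c]] this]
  have "openin (subtopology X (fst c)) {q \<in> fst c. snd c q \<in> chart_image c \<inter> W}"
    unfolding topspace_chart_domain[OF c] .
  moreover have "{q \<in> fst c. snd c q \<in> chart_image c \<inter> W} = {q \<in> fst c. snd c q \<in> W}" by auto
  ultimately show ?thesis
    using openin_trans_full openin_chart_domain[OF c] by metis
qed

lemma open_overlap: "c \<in> A \<Longrightarrow> c' \<in> A \<Longrightarrow> open (overlap c c')"
  by (intro open_chart_image_of_openin openin_Int openin_chart_domain) auto

lemma smooth_on_transition: "c \<in> A \<Longrightarrow> c' \<in> A \<Longrightarrow> smooth_on (transition c c') (overlap c c')"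
  using smooth_manifold by (simp add: smooth_manifold_def)

lemma has_derivative_transition:
  assumes "c \<in> charts_at A q" "c' \<in> charts_at A q"
  shows "(transition c c' has_derivative jacobian c c' q) (at (snd c q))"
  using assms by (intro smooth_on_imp_has_derivative[OF smooth_on_transition]) (auto simp: charts_at_def)

lemma linear_jacobian: "c \<in> charts_at A q \<Longrightarrow> c' \<in> charts_at A q \<Longrightarrow> linear (jacobian c c' q)"
  using has_derivative_linear[OF has_derivative_transition] .

lemma jacobian_refl:
  assumes "c \<in> charts_at A q"
  shows "jacobian c c q v = v"
proof -
  have c: "c \<in> A" "q \<in> fst c" using assms by (auto simp: charts_at_def)
  have "((\<lambda>x. x) has_derivative (\<lambda>x. x)) (at (snd c q))" by simp
  then have "(transition c c has_derivative (\<lambda>x. x)) (at (snd c q))"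
    by (rule has_derivative_transform_within_open[OF _ open_chart_image[OF c(1)]])
      (use c in \<open>auto simp: transition_chart\<close>)
  from has_derivative_unique[OF has_derivative_transition[OF assms assms] this]
  show ?thesis by metis
qed

lemma jacobian_trans:
  assumes "c \<in> charts_at A q" "c' \<in> charts_at A q" "c'' \<in> charts_at A q"
  shows "jacobian c' c'' q (jacobian c c' q v) = jacobian c c'' q v"
proof -
  have c: "c \<in> A" "c' \<in> A" "c'' \<in> A" "q \<in> fst c" "q \<in> fst c'" "q \<in> fst c''"
    using assms by (auto simp: charts_at_def)
  have "((transition c' c'' \<circ> transition c c') has_derivative (jacobian c' c'' q \<circ> jacobian c c' q)) (at (snd c q))"
    using has_derivative_transition[OF assms(1,2)] has_derivative_transition[OF assms(2,3)]
    by (intro diff_chain_at) (simp_all add: transition_chart c)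
  \<comment> \<open>The composite agrees with the direct transition on all of
    \<open>overlap c c'\<close>, even at points outside \<open>fst c''\<close>, because
    \<open>snd c''\<close> is a total function.\<close>
  then have "(transition c c'' has_derivative (jacobian c' c'' q \<circ> jacobian c c' q)) (at (snd c q))"
    by (rule has_derivative_transform_within_open[OF _ open_overlap[OF c(1,2)]])
      (use c in \<open>auto simp: transition_chart\<close>)
  from has_derivative_unique[OF this has_derivative_transition[OF assms(1,3)]]
  show ?thesis by (metis comp_apply)
qed

section \<open>Tangent vectors and pointwise forms in the coordinates of a chart\<close>

text \<open>Compatibility between charts is the cocycle rule \<open>jacobian_trans\<close>. Together
  with \<open>tangent_of_apply\<close> and \<open>tangent_of_coordinates\<close> this makes
  \<open>tangent_of A c q\<close> a bijection from \<open>'e\<close> onto the tangent space.\<close>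

lemma tangent_of_in_tangent_space:
  assumes "c \<in> charts_at A q"
  shows "tangent_of A c q v \<in> tangent_space A q"
  using assms by (simp add: tangent_space_def tangent_of_def jacobian_trans)

lemma tangent_of_apply: "c \<in> charts_at A q \<Longrightarrow> tangent_of A c q v c = v"
  by (simp add: tangent_of_def jacobian_refl)

lemma tangent_of_coordinates:
  assumes "c \<in> charts_at A q" "t \<in> tangent_space A q"
  shows "tangent_of A c q (t c) = t"
proof
  fix c'
  show "tangent_of A c q (t c) c' = t c'"
  proof (cases "c' \<in> charts_at A q")
    case True
    then have "t c' = jacobian c c' q (t c)" using assms unfolding tangent_space_def by blast
    then show ?thesis using True by (simp add: tangent_of_def)
  next
    case False
    then have "t c' = 0" using assms unfolding tangent_space_def by blast
    then show ?thesis using False by (simp add: tangent_of_def)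
  qed
qed

lemma tangent_of_change_chart:
  assumes "c \<in> charts_at A q" "c' \<in> charts_at A q"
  shows "tangent_of A c' q (jacobian c c' q v) = tangent_of A c q v"
  using assms by (auto simp: tangent_of_def fun_eq_iff jacobian_trans)

text \<open>The coefficients \<open>1\<close> here, and \<open>0\<close> in the lemma on scaling,
  produce the shape of linear combination in which \<open>alternating_form\<close> states
  linearity.\<close>

lemma tangent_of_add:
  assumes "c \<in> charts_at A q"
  shows "tangent_of A c q (u + v) = (\<lambda>c'. 1 *\<^sub>R tangent_of A c q u c' + 1 *\<^sub>R tangent_of A c q v c')"
  using assms linear_add[OF linear_jacobian] by (auto simp: tangent_of_def fun_eq_iff)

lemma tangent_of_scale:
  assumes "c \<in> charts_at A q"
  shows "tangent_of A c q (a *\<^sub>R u) = (\<lambda>c'. a *\<^sub>R tangent_of A c q u c' + 0 *\<^sub>R tangent_of A c q u c')"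
  using assms linear_scale[OF linear_jacobian] by (auto simp: tangent_of_def fun_eq_iff)

lemma tuples_tangent_space:
  assumes c: "c \<in> charts_at A q"
  shows "tuples (tangent_space A q) k = map (tangent_of A c q) ` tuples UNIV k"
proof
  show "tuples (tangent_space A q) k \<subseteq> map (tangent_of A c q) ` tuples UNIV k"
  proof
    fix ts assume ts: "ts \<in> tuples (tangent_space A q) k"
    then have "map (tangent_of A c q) (map (\<lambda>t. t c) ts) = ts"
      by (auto simp: tuples_def tangent_of_coordinates[OF c] intro!: map_idI)
    moreover have "map (\<lambda>t. t c) ts \<in> tuples UNIV k" using ts by (simp add: tuples_def)
    ultimately show "ts \<in> map (tangent_of A c q) ` tuples UNIV k" by force
  qed
  show "map (tangent_of A c q) ` tuples UNIV k \<subseteq> tuples (tangent_space A q) k"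
    using tangent_of_in_tangent_space[OF c] by (auto simp: tuples_def)
qed

text \<open>The pullback of a form at one point to the type \<open>'e\<close>, where the linear
  algebra above applies; \<open>local_rep\<close> is the corresponding family over the image of the
  chart.\<close>

definition in_coordinates ::
  "('a, 'e) chart \<Rightarrow> 'a \<Rightarrow> (('a, 'e) tangent list \<Rightarrow> real) \<Rightarrow> 'e list \<Rightarrow> real" where
  "in_coordinates c q \<Omega> vs = \<Omega> (map (tangent_of A c q) vs)"

lemma form_eq_in_coordinates:
  assumes "c \<in> charts_at A q"
  shows "form_eq (tangent_space A q) k \<Omega> \<Theta> \<longleftrightarrow>
         form_eq UNIV k (in_coordinates c q \<Omega>) (in_coordinates c q \<Theta>)"
  by (simp add: form_eq_def tuples_tangent_space[OF assms] in_coordinates_def)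

lemma form_zero_in_coordinates:
  assumes "c \<in> charts_at A q"
  shows "form_zero (tangent_space A q) k \<Omega> \<longleftrightarrow> form_zero UNIV k (in_coordinates c q \<Omega>)"
  by (simp add: form_eq_def tuples_tangent_space[OF assms] in_coordinates_def)

text \<open>By naturality of \<open>wedge_power\<close> each power vanishes on one side exactly when
  it vanishes on the other, so the greatest exponents coincide.\<close>

lemma form_rank_in_coordinates:
  assumes "c \<in> charts_at A q"
  shows "form_rank (tangent_space A q) \<Omega> = form_rank UNIV (in_coordinates c q \<Omega>)"
proof -
  have "form_zero (tangent_space A q) (2 * p) (wedge_power \<Omega> p) \<longleftrightarrow>
        form_zero UNIV (2 * p) (wedge_power (in_coordinates c q \<Omega>) p)" for p
    unfolding form_eq_def tuples_tangent_space[OF assms] in_coordinates_def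
    by (auto simp: tuples_def wedge_power_map)
  then show ?thesis by (simp add: form_rank_def)
qed

lemma alternating_in_coordinates:
  assumes c: "c \<in> charts_at A q" and \<Omega>: "alternating_form A q k \<Omega>"
  shows "alternating k (in_coordinates c q \<Omega>)"
  unfolding alternating_def multilinear_def
proof (intro conjI allI impI)
  note mem = tangent_of_in_tangent_space[OF c]
  have tup: "map (tangent_of A c q) vs \<in> tuples (tangent_space A q) k" if "length vs = k" for vs
    using that mem by (auto simp: tuples_def)
  fix vs :: "'e list" assume vs: "length vs = k"
  { fix i assume i: "i < k"
    have *: "\<Omega> ((map (tangent_of A c q) vs)[i := (\<lambda>c'. a *\<^sub>R tangent_of A c q u c' + b *\<^sub>R tangent_of A c q w c')])
       = a * \<Omega> ((map (tangent_of A c q) vs)[i := tangent_of A c q u])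
       + b * \<Omega> ((map (tangent_of A c q) vs)[i := tangent_of A c q w])" for u w a b
      using \<Omega> tup[OF vs] mem i unfolding alternating_form_def by blast
    show "linear (\<lambda>u. in_coordinates c q \<Omega> (vs[i := u]))"
    proof (rule linearI)
      fix u w :: 'e and a :: real
      show "in_coordinates c q \<Omega> (vs[i := u + w])
          = in_coordinates c q \<Omega> (vs[i := u]) + in_coordinates c q \<Omega> (vs[i := w])"
        unfolding in_coordinates_def map_update tangent_of_add[OF c] * by simp
      show "in_coordinates c q \<Omega> (vs[i := a *\<^sub>R u]) = a *\<^sub>R in_coordinates c q \<Omega> (vs[i := u])"
        unfolding in_coordinates_def map_update tangent_of_scale[OF c] * by simp
    qed }
  assume "\<not> distinct vs"
  then obtain i j where ij: "i < k" "j < k" "i \<noteq> j" "vs ! i = vs ! j"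
    using vs by (auto simp: distinct_conv_nth)
  then have "map (tangent_of A c q) vs ! i = map (tangent_of A c q) vs ! j" using vs by simp
  then show "in_coordinates c q \<Omega> vs = 0"
    using \<Omega> tup[OF vs] ij unfolding alternating_form_def in_coordinates_def by blast
qed

section \<open>Differential forms and exterior derivatives in a chart\<close>

lemma local_rep_chart:
  assumes "c \<in> charts_at A q"
  shows "local_rep A c \<omega> (snd c q) = in_coordinates c q (\<omega> q)"
  using assms by (simp add: local_rep_def in_coordinates_def charts_at_def fun_eq_iff)

lemma ext_deriv_in_2:
  assumes "c \<in> charts_at A q"
  shows "ext_deriv_in A c 2 \<omega> q (map (tangent_of A c q) [u, v, w])
    = frechet_derivative (\<lambda>x. local_rep A c \<omega> x [v, w]) (at (snd c q)) u
    - frechet_derivative (\<lambda>x. local_rep A c \<omega> x [u, w]) (at (snd c q)) v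
    + frechet_derivative (\<lambda>x. local_rep A c \<omega> x [u, v]) (at (snd c q)) w"
  by (simp add: ext_deriv_in_def numeral_2_eq_2 tangent_of_apply[OF assms])

lemma ext_deriv_in_1:
  assumes "c \<in> charts_at A q"
  shows "ext_deriv_in A c 1 \<beta> q (map (tangent_of A c q) [u, v])
    = frechet_derivative (\<lambda>x. local_rep A c \<beta> x [v]) (at (snd c q)) u
    - frechet_derivative (\<lambda>x. local_rep A c \<beta> x [u]) (at (snd c q)) v"
  by (simp add: ext_deriv_in_def tangent_of_apply[OF assms])

lemma chart_image_cases:
  assumes "c \<in> A" "x \<in> chart_image c"
  obtains q where "x = snd c q" "c \<in> charts_at A q" "q \<in> topspace X"
proof -
  obtain q where q: "q \<in> fst c" "x = snd c q" using assms by auto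
  then have "q \<in> topspace X" using openin_subset[OF openin_chart_domain[OF assms(1)]] by auto
  then show thesis using that q assms by (auto simp: charts_at_def)
qed

lemma alternating_local_rep:
  assumes "smooth_form X A k \<omega>" "c \<in> A" "x \<in> chart_image c"
  shows "alternating k (local_rep A c \<omega> x)"
proof -
  obtain q where "x = snd c q" "c \<in> charts_at A q" "q \<in> topspace X"
    using chart_image_cases[OF assms(2,3)] .
  then show ?thesis
    using assms(1) by (simp add: local_rep_chart alternating_in_coordinates smooth_form_def)
qed

lemma smooth_on_local_rep:
  "smooth_form X A k \<omega> \<Longrightarrow> c \<in> A \<Longrightarrow> length vs = k \<Longrightarrow>
    smooth_on (\<lambda>x. local_rep A c \<omega> x vs) (chart_image c)"
  by (simp add: smooth_form_def)

text \<open>On the overlap the local representation in \<open>c\<close> is the pullback, by the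
  transition map, of the one in \<open>c'\<close>, so \<open>exterior_derivative_pullback\<close>
  applies.\<close>

lemma ext_deriv_in_2_change_chart:
  assumes \<omega>: "smooth_form X A 2 \<omega>" and c: "c \<in> charts_at A q" and c': "c' \<in> charts_at A q"
    and ts: "ts \<in> tuples (tangent_space A q) 3"
  shows "ext_deriv_in A c 2 \<omega> q ts = ext_deriv_in A c' 2 \<omega> q ts"
proof -
  have cA: "c \<in> A" "c' \<in> A" and q: "q \<in> fst c" "q \<in> fst c'" using c c' by (auto simp: charts_at_def)
  obtain u v w where ts_eq: "ts = map (tangent_of A c q) [u, v, w]"
    using ts unfolding tuples_tangent_space[OF c] by (auto simp: tuples_def length_3_conv)
  then have ts_eq': "ts = map (tangent_of A c' q) [jacobian c c' q u, jacobian c c' q v, jacobian c c' q w]"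
    by (simp add: tangent_of_change_chart[OF c c'])
  let ?W = "\<lambda>y a b. local_rep A c' \<omega> y [a, b]" and ?V = "\<lambda>y a b. local_rep A c \<omega> y [a, b]"
  have tr: "transition c c' (snd c q) = snd c' q" using cA q by (simp add: transition_chart)
  have "frechet_derivative (\<lambda>y. ?V y v w) (at (snd c q)) u - frechet_derivative (\<lambda>y. ?V y u w) (at (snd c q)) v
         + frechet_derivative (\<lambda>y. ?V y u v) (at (snd c q)) w
    = frechet_derivative (\<lambda>y. ?W y (jacobian c c' q v) (jacobian c c' q w)) (at (snd c' q)) (jacobian c c' q u)
    - frechet_derivative (\<lambda>y. ?W y (jacobian c c' q u) (jacobian c c' q w)) (at (snd c' q)) (jacobian c c' q v)
    + frechet_derivative (\<lambda>y. ?W y (jacobian c c' q u) (jacobian c c' q v)) (at (snd c' q)) (jacobian c c' q w)"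
  proof (rule exterior_derivative_pullback[where T = "overlap c c'" and U = "overlap c' c" and \<phi> = "transition c c'" and W = ?W
        and D = "\<lambda>a b. frechet_derivative (\<lambda>y. ?W y a b) (at (snd c' q))"])
    show "open (overlap c c')" "open (overlap c' c)" using cA by (auto intro: open_overlap)
    show "snd c q \<in> overlap c c'" using q by auto
    show "transition c c' ` overlap c c' \<subseteq> overlap c' c"
      using cA by (auto simp: transition_chart)
    show "alternating_bilinear (?W y)" if "y \<in> overlap c' c" for y
      using alternating_bilinear_of_alternating[OF alternating_local_rep[OF \<omega> cA(2)]] that by auto
    show "((\<lambda>y. ?W y a b) has_derivative frechet_derivative (\<lambda>y. ?W y a b) (at (snd c' q)))
        (at (transition c c' (snd c q)))" for a b
      unfolding tr using q by (intro smooth_on_imp_has_derivative[OF smooth_on_local_rep[OF \<omega> cA(2)]]) auto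
    show "smooth_on (transition c c') (overlap c c')" using cA by (rule smooth_on_transition)
    fix y a b assume "y \<in> overlap c c'"
    then obtain p where p: "y = snd c p" "p \<in> fst c" "p \<in> fst c'" by auto
    then have cp: "c \<in> charts_at A p" "c' \<in> charts_at A p" using cA by (auto simp: charts_at_def)
    show "?V y a b = ?W (transition c c' y) (frechet_derivative (transition c c') (at y) a)
        (frechet_derivative (transition c c') (at y) b)"
      using p cA by (simp add: transition_chart local_rep_chart[OF cp(1)] local_rep_chart[OF cp(2)]
          in_coordinates_def tangent_of_change_chart[OF cp])
  qed
  then show ?thesis unfolding ts_eq' ext_deriv_in_2[OF c']
    unfolding ts_eq'[symmetric] ts_eq ext_deriv_in_2[OF c] .
qed

text \<open>\<open>ext_deriv\<close> may select a different chart at each point. Replacing it by one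
  chart on its whole domain makes an equation for d\<omega> available for a further
  differentiation.\<close>

lemma ext_deriv_2:
  assumes "smooth_form X A 2 \<omega>" "c \<in> charts_at A q" "ts \<in> tuples (tangent_space A q) 3"
  shows "ext_deriv A 2 \<omega> q ts = ext_deriv_in A c 2 \<omega> q ts"
proof -
  have "(SOME c. c \<in> charts_at A q) \<in> charts_at A q" using assms(2) by (rule someI)
  then show ?thesis
    unfolding ext_deriv_def using assms by (intro ext_deriv_in_2_change_chart)
qed

lemma wedge_form_in_coordinates:
  shows "wedge_form 1 2 \<beta> \<omega> q (map (tangent_of A c q) [u, v, w])
       = wedge 1 2 (in_coordinates c q (\<beta> q)) (in_coordinates c q (\<omega> q)) [u, v, w]"
proof -
  have "length [u, v, w] = 1 + 2" by simp
  from wedge_map[OF this, of "\<beta> q" "tangent_of A c q" "\<omega> q"] show ?thesis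
    unfolding wedge_form_def in_coordinates_def[abs_def] by simp
qed

lemma closed_up_to_factor_in_coordinates:
  assumes \<omega>: "smooth_form X A 2 \<omega>"
    and eq: "form_eq_on (topspace X) A 3 (ext_deriv A 2 \<omega>) (wedge_form 1 2 \<beta> \<omega>)"
    and c: "c \<in> A" and x: "x \<in> chart_image c"
  shows "frechet_derivative (\<lambda>x. local_rep A c \<omega> x [v, w]) (at x) u
    - frechet_derivative (\<lambda>x. local_rep A c \<omega> x [u, w]) (at x) v
    + frechet_derivative (\<lambda>x. local_rep A c \<omega> x [u, v]) (at x) w
    = wedge 1 2 (local_rep A c \<beta> x) (local_rep A c \<omega> x) [u, v, w]"
proof -
  obtain q where q: "x = snd c q" "c \<in> charts_at A q" "q \<in> topspace X"
    using chart_image_cases[OF c x] .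
  let ?ts = "map (tangent_of A c q) [u, v, w]"
  have ts: "?ts \<in> tuples (tangent_space A q) 3"
    unfolding tuples_tangent_space[OF q(2)] by (rule imageI) (simp add: tuples_def)
  have "ext_deriv A 2 \<omega> q ?ts = wedge_form 1 2 \<beta> \<omega> q ?ts"
    using eq ts q(3) unfolding form_eq_on_def form_eq_def by blast
  then show ?thesis
    unfolding ext_deriv_2[OF \<omega> q(2) ts] ext_deriv_in_2[OF q(2)] wedge_form_in_coordinates
      q(1) local_rep_chart[OF q(2)] .
qed

lemma linear_local_rep_1:
  assumes "smooth_form X A 1 \<beta>" "c \<in> A" "x \<in> chart_image c"
  shows "linear (\<lambda>v. local_rep A c \<beta> x [v])"
proof -
  have "linear (\<lambda>u. local_rep A c \<beta> x ([undefined][0 := u]))"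
    using alternating_local_rep[OF assms] unfolding alternating_def multilinear_def
    by (metis One_nat_def length_Cons less_one list.size(3))
  then show ?thesis by simp
qed

text \<open>d\<beta> enters pointwise and is not differentiated again, so the chart can be taken to
  be the one that \<open>ext_deriv\<close> selects at \<open>q\<close>.\<close>

lemma ext_deriv_1_in_coordinates:
  assumes q: "q \<in> topspace X"
  obtains c where "c \<in> charts_at A q"
    and "\<And>\<beta> u v. in_coordinates c q (ext_deriv A 1 \<beta> q) [u, v]
           = frechet_derivative (\<lambda>x. local_rep A c \<beta> x [v]) (at (snd c q)) u
           - frechet_derivative (\<lambda>x. local_rep A c \<beta> x [u]) (at (snd c q)) v"
proof -
  have "\<exists>c. c \<in> charts_at A q"
    using q smooth_manifold unfolding smooth_manifold_def charts_at_def by blast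
  then have c: "(SOME c. c \<in> charts_at A q) \<in> charts_at A q" by (rule someI_ex)
  show thesis
    by (rule that[OF c]) (unfold ext_deriv_def in_coordinates_def, rule ext_deriv_in_1[OF c])
qed

text \<open>Linearity in the direction of differentiation is that of a derivative; linearity in the
  argument of \<beta> comes from differentiating the linearity of \<beta>, which holds on the whole
  chart image.\<close>

lemma alternating_ext_deriv_1:
  assumes \<beta>: "smooth_form X A 1 \<beta>" and c: "c \<in> charts_at A q"
    and E: "\<And>u v. E [u, v]
           = frechet_derivative (\<lambda>x. local_rep A c \<beta> x [v]) (at (snd c q)) u
           - frechet_derivative (\<lambda>x. local_rep A c \<beta> x [u]) (at (snd c q)) v"
  shows "alternating 2 E"
proof -
  let ?x = "snd c q"
  let ?D = "\<lambda>v. frechet_derivative (\<lambda>x. local_rep A c \<beta> x [v]) (at ?x)"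
  have cA: "c \<in> A" and x: "?x \<in> chart_image c" using c by (auto simp: charts_at_def)
  have D: "((\<lambda>x. local_rep A c \<beta> x [v]) has_derivative ?D v) (at ?x)" for v
    using x by (intro smooth_on_imp_has_derivative[OF smooth_on_local_rep[OF \<beta> cA]]) auto
  have lin1: "linear (?D v)" for v using has_derivative_linear[OF D] .
  have lin2: "linear (\<lambda>v. ?D v u)" for u
  proof (rule linearI)
    fix v w :: 'e and r :: real
    have "((\<lambda>x. local_rep A c \<beta> x [v] + local_rep A c \<beta> x [w]) has_derivative (\<lambda>h. ?D v h + ?D w h)) (at ?x)"
      by (intro has_derivative_add D)
    then have "((\<lambda>x. local_rep A c \<beta> x [v + w]) has_derivative (\<lambda>h. ?D v h + ?D w h)) (at ?x)"
      by (rule has_derivative_transform_within_open[OF _ open_chart_image[OF cA] x])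
        (simp add: linear_add[OF linear_local_rep_1[OF \<beta> cA]])
    from has_derivative_unique[OF D this] show "?D (v + w) u = ?D v u + ?D w u" by metis
    have "((\<lambda>x. r * local_rep A c \<beta> x [v]) has_derivative (\<lambda>h. r * ?D v h)) (at ?x)"
      by (intro has_derivative_mult_right D)
    then have "((\<lambda>x. local_rep A c \<beta> x [r *\<^sub>R v]) has_derivative (\<lambda>h. r * ?D v h)) (at ?x)"
      by (rule has_derivative_transform_within_open[OF _ open_chart_image[OF cA] x])
        (simp add: linear_scale[OF linear_local_rep_1[OF \<beta> cA]])
    from has_derivative_unique[OF D this] show "?D (r *\<^sub>R v) u = r *\<^sub>R ?D v u" by simp
  qed
  have "alternating_bilinear (\<lambda>u v. E [u, v])"
    unfolding alternating_bilinear_def bilinear_def E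
    using lin1 lin2 by (auto intro!: linear_compose_sub)
  then show ?thesis by (rule alternating_of_alternating_bilinear)
qed

text \<open>This is \<omega> \<and> d\<beta> = 0 at \<open>q\<close> in six-term form, obtained from
  the equation for d\<omega> read on the whole image of \<open>c\<close>.\<close>

lemma wedge_ext_deriv_eq_0:
  assumes \<omega>: "smooth_form X A 2 \<omega>" and \<beta>: "smooth_form X A 1 \<beta>"
    and d\<omega>: "form_eq_on (topspace X) A 3 (ext_deriv A 2 \<omega>) (wedge_form 1 2 \<beta> \<omega>)"
    and c: "c \<in> charts_at A q"
    and E: "\<And>u v. E [u, v]
           = frechet_derivative (\<lambda>x. local_rep A c \<beta> x [v]) (at (snd c q)) u
           - frechet_derivative (\<lambda>x. local_rep A c \<beta> x [u]) (at (snd c q)) v"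
    and W: "W = in_coordinates c q (\<omega> q)"
  shows "W [x, y] * E [z, w] - W [x, z] * E [y, w] + W [x, w] * E [y, z]
       + W [y, z] * E [x, w] - W [y, w] * E [x, z] + W [z, w] * E [x, y] = 0"
proof -
  have cA: "c \<in> A" and q: "snd c q \<in> chart_image c" using c by (auto simp: charts_at_def)
  note alt = alternating_bilinear_of_alternating[OF alternating_local_rep[OF \<omega> cA]]
  show ?thesis
    unfolding W local_rep_chart[OF c, symmetric]
  proof (rule wedge_exterior_derivative_eq_0[where U = "chart_image c" and x = "snd c q"
        and W = "\<lambda>y a b. local_rep A c \<omega> y [a, b]" and B = "\<lambda>y a. local_rep A c \<beta> y [a]"
        and E = "\<lambda>a b. E [a, b]", OF open_chart_image[OF cA] q _ _ _ E])
    show "smooth_on (\<lambda>y. local_rep A c \<omega> y [a, b]) (chart_image c)" for a b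
      by (rule smooth_on_local_rep[OF \<omega> cA]) simp
    show "smooth_on (\<lambda>y. local_rep A c \<beta> y [a]) (chart_image c)" for a
      by (rule smooth_on_local_rep[OF \<beta> cA]) simp
  qed (simp only: closed_up_to_factor_in_coordinates[OF \<omega> d\<omega> cA] wedge_1_2_expand[OF alt])
qed

section \<open>Openness, rank bounds and uniqueness of the factor\<close>

text \<open>Lower semicontinuity of the rank: in a chart, a power that is nonzero at
  \<open>q\<close> on some tuple of constant vectors stays nonzero on that tuple nearby, by
  continuity.\<close>

lemma openin_rank_gt:
  assumes \<omega>: "smooth_form X A 2 \<omega>"
  shows "openin X {q \<in> topspace X. rank_at A \<omega> q > r}"
proof (subst openin_subopen, intro ballI)
  fix q assume "q \<in> {q \<in> topspace X. rank_at A \<omega> q > r}"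
  then have q: "q \<in> topspace X" "rank_at A \<omega> q > r" by auto
  obtain c where c: "c \<in> charts_at A q"
    using q smooth_manifold unfolding smooth_manifold_def charts_at_def by blast
  have cA: "c \<in> A" and qc: "q \<in> fst c" using c by (auto simp: charts_at_def)
  let ?\<Omega> = "local_rep A c \<omega>" and ?U = "chart_image c"
  have mult: "multilinear 2 (?\<Omega> x)" if "x \<in> ?U" for x
    using alternating_local_rep[OF \<omega> cA that] by (simp add: alternating_def)
  have rank: "rank_at A \<omega> q' = form_rank UNIV (?\<Omega> (snd c q'))" if "q' \<in> fst c" for q'
  proof -
    have "c \<in> charts_at A q'" using that cA by (simp add: charts_at_def)
    then show ?thesis by (simp add: rank_at_def form_rank_in_coordinates local_rep_chart)
  qed
  define p where "p = form_rank UNIV (?\<Omega> (snd c q))"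
  have p: "p > r" using q(2) rank[OF qc] by (simp add: p_def)
  obtain vs where vs: "length vs = 2 * p" "wedge_power (?\<Omega> (snd c q)) p vs \<noteq> 0"
    using wedge_power_form_rank[OF mult] qc unfolding p_def form_eq_def tuples_def by blast
  have "continuous_on ?U (\<lambda>x. wedge_power (?\<Omega> x) p vs)"
    using smooth_on_imp_continuous_on[OF smooth_on_local_rep[OF \<omega> cA]]
    by (rule continuous_on_wedge_power)
  then have "open (?U \<inter> (\<lambda>x. wedge_power (?\<Omega> x) p vs) -` (- {0}))"
    by (rule continuous_open_preimage) (auto intro: open_chart_image[OF cA])
  then have "openin X {q' \<in> fst c. snd c q' \<in> ?U \<inter> (\<lambda>x. wedge_power (?\<Omega> x) p vs) -` (- {0})}" (is "openin X ?T")
    by (rule openin_chart_preimage[OF cA])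
  moreover have "q \<in> ?T" using qc vs by auto
  moreover have "?T \<subseteq> {q \<in> topspace X. rank_at A \<omega> q > r}"
  proof
    fix q' assume q': "q' \<in> ?T"
    then have "\<not> form_zero UNIV (2 * p) (wedge_power (?\<Omega> (snd c q')) p)"
      using vs(1) by (auto simp: form_eq_def tuples_def)
    then have "p \<le> form_rank UNIV (?\<Omega> (snd c q'))"
      using q' by (intro le_form_rank mult) auto
    then show "q' \<in> {q \<in> topspace X. rank_at A \<omega> q > r}"
      using q' p rank openin_subset[OF openin_chart_domain[OF cA]] by auto
  qed
  ultimately show "\<exists>T. openin X T \<and> q \<in> T \<and> T \<subseteq> {q \<in> topspace X. rank_at A \<omega> q > r}" by blast
qed

text \<open>The bound on the rank of \<omega> rests on d\<beta> \<noteq> 0 and yields, by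
  contraposition, that d\<beta> vanishes where the rank exceeds \<open>2\<close>. The bound on the
  rank of d\<beta> is the same argument with the two forms exchanged, so it asks for \<omega>
  \<noteq> 0.\<close>

lemma rank_bounds_of_ext_deriv_nonzero:
  assumes \<omega>: "smooth_form X A 2 \<omega>" and \<beta>: "smooth_form X A 1 \<beta>"
    and eq: "form_eq_on (topspace X) A 3 (ext_deriv A 2 \<omega>) (wedge_form 1 2 \<beta> \<omega>)"
    and q: "q \<in> topspace X" and nz: "\<not> form_zero (tangent_space A q) 2 (ext_deriv A 1 \<beta> q)"
  shows "1 \<le> rank_at A (ext_deriv A 1 \<beta>) q" and "rank_at A \<omega> q \<le> 2"
    and "\<not> form_zero (tangent_space A q) 2 (\<omega> q) \<Longrightarrow>
           rank_at A (ext_deriv A 1 \<beta>) q \<le> 2 \<and> 1 \<le> rank_at A \<omega> q"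
proof -
  obtain c where c: "c \<in> charts_at A q"
    and E: "\<And>\<beta> u v. in_coordinates c q (ext_deriv A 1 \<beta> q) [u, v]
           = frechet_derivative (\<lambda>x. local_rep A c \<beta> x [v]) (at (snd c q)) u
           - frechet_derivative (\<lambda>x. local_rep A c \<beta> x [u]) (at (snd c q)) v"
    using ext_deriv_1_in_coordinates[OF q] by blast
  let ?E = "in_coordinates c q (ext_deriv A 1 \<beta> q)" and ?W = "in_coordinates c q (\<omega> q)"
  have altE: "alternating 2 ?E" by (rule alternating_ext_deriv_1[OF \<beta> c E])
  have altW: "alternating 2 ?W"
    using \<omega> q by (intro alternating_in_coordinates[OF c]) (simp add: smooth_form_def)
  note wedge = wedge_ext_deriv_eq_0[OF \<omega> \<beta> eq c E refl]
  have nzE: "\<not> form_zero UNIV 2 ?E" using nz by (simp add: form_zero_in_coordinates[OF c])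
  show "1 \<le> rank_at A (ext_deriv A 1 \<beta>) q"
    using one_le_form_rank[OF altE nzE] by (simp add: rank_at_def form_rank_in_coordinates[OF c])
  show "rank_at A \<omega> q \<le> 2"
    using form_rank_le_2_of_wedge_eq_0[OF altW altE wedge nzE]
    by (simp add: rank_at_def form_rank_in_coordinates[OF c])
  assume "\<not> form_zero (tangent_space A q) 2 (\<omega> q)"
  then have nzW: "\<not> form_zero UNIV 2 ?W" by (simp add: form_zero_in_coordinates[OF c])
  have "form_rank UNIV ?E \<le> 2"
  \<comment> \<open>The six-term expression is symmetric in the two \<open>2\<close>-forms, so their
    roles can be exchanged.\<close>
  proof (rule form_rank_le_2_of_wedge_eq_0[OF altE altW _ nzW])
    fix x y z w
    show "?E [x, y] * ?W [z, w] - ?E [x, z] * ?W [y, w] + ?E [x, w] * ?W [y, z]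
        + ?E [y, z] * ?W [x, w] - ?E [y, w] * ?W [x, z] + ?E [z, w] * ?W [x, y] = 0"
      using wedge[of x y z w] by (simp add: algebra_simps)
  qed
  then show "rank_at A (ext_deriv A 1 \<beta>) q \<le> 2 \<and> 1 \<le> rank_at A \<omega> q"
    using one_le_form_rank[OF altW nzW] by (simp add: rank_at_def form_rank_in_coordinates[OF c])
qed

text \<open>If \<beta>' and \<beta> differ at a point, then in a chart they differ on a fixed vector
  throughout a nonempty open set. That set contains a point where \<omega> has rank above
  \<open>1\<close>, which contradicts (\<beta>' - \<beta>) \<and> \<omega> = 0 there.\<close>

lemma wedge_1_2_factor_unique:
  assumes \<omega>: "smooth_form X A 2 \<omega>" and \<beta>: "smooth_form X A 1 \<beta>" and \<beta>': "smooth_form X A 1 \<beta>'"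
    and eq: "form_eq_on (topspace X) A 3 (wedge_form 1 2 \<beta>' \<omega>) (wedge_form 1 2 \<beta> \<omega>)"
    and C: "nowhere_dense_in X {q \<in> topspace X. rank_at A \<omega> q \<le> 1}"
  shows "form_eq_on (topspace X) A 1 \<beta>' \<beta>"
proof (rule ccontr)
  assume "\<not> form_eq_on (topspace X) A 1 \<beta>' \<beta>"
  then obtain q where q: "q \<in> topspace X" "\<not> form_eq (tangent_space A q) 1 (\<beta>' q) (\<beta> q)"
    by (auto simp: form_eq_on_def)
  obtain c where c: "c \<in> charts_at A q"
    using q smooth_manifold unfolding smooth_manifold_def charts_at_def by blast
  have cA: "c \<in> A" and qc: "q \<in> fst c" using c by (auto simp: charts_at_def)
  let ?g = "\<lambda>x v. local_rep A c \<beta>' x v - local_rep A c \<beta> x v" and ?U = "chart_image c"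
  obtain v where v: "?g (snd c q) [v] \<noteq> 0"
    using q(2) unfolding form_eq_in_coordinates[OF c] local_rep_chart[OF c]
    by (auto simp: form_eq_def tuples_def length_Suc_conv)
  have "continuous_on ?U (\<lambda>x. ?g x [v])"
    by (intro continuous_on_diff smooth_on_imp_continuous_on smooth_on_local_rep[OF \<beta>' cA]
        smooth_on_local_rep[OF \<beta> cA]) simp_all
  then have "open (?U \<inter> (\<lambda>x. ?g x [v]) -` (- {0}))"
    by (rule continuous_open_preimage) (auto intro: open_chart_image[OF cA])
  then have "openin X {q' \<in> fst c. snd c q' \<in> ?U \<inter> (\<lambda>x. ?g x [v]) -` (- {0})}" (is "openin X ?T")
    by (rule openin_chart_preimage[OF cA])
  moreover have "q \<in> ?T" using qc v by auto
  \<comment> \<open>A nonempty open subset of the set of rank at most \<open>1\<close> would lie in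
    the interior of the closure of that set.\<close>
  ultimately have "\<not> ?T \<subseteq> {q \<in> topspace X. rank_at A \<omega> q \<le> 1}"
    using C interior_of_maximal[of ?T "X closure_of {q \<in> topspace X. rank_at A \<omega> q \<le> 1}" X]
      closure_of_subset[of "{q \<in> topspace X. rank_at A \<omega> q \<le> 1}" X]
    unfolding nowhere_dense_in_def by blast
  then obtain p where p: "p \<in> ?T" "\<not> rank_at A \<omega> p \<le> 1" and pX: "p \<in> topspace X"
    using openin_subset[OF openin_chart_domain[OF cA]] by blast
  have cp: "c \<in> charts_at A p" using p cA by (simp add: charts_at_def)
  let ?x = "snd c p"
  have xU: "?x \<in> ?U" using p by auto
  have altW: "alternating 2 (local_rep A c \<omega> ?x)" by (rule alternating_local_rep[OF \<omega> cA xU])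
  note expand = wedge_1_2_expand[OF alternating_bilinear_of_alternating[OF altW]]
  have "form_rank UNIV (local_rep A c \<omega> ?x) \<le> 1"
  proof (rule form_rank_le_1_of_wedge_eq_0[OF altW, where \<alpha> = "?g ?x" and ?a0.0 = v])
    show "linear (\<lambda>v. ?g ?x [v])"
      by (intro linear_compose_sub linear_local_rep_1[OF \<beta>' cA xU] linear_local_rep_1[OF \<beta> cA xU])
    show "?g ?x [v] \<noteq> 0" using p by auto
    fix u v w
    let ?ts = "map (tangent_of A c p) [u, v, w]"
    have "?ts \<in> tuples (tangent_space A p) 3"
      unfolding tuples_tangent_space[OF cp] by (rule imageI) (simp add: tuples_def)
    then have "wedge_form 1 2 \<beta>' \<omega> p ?ts = wedge_form 1 2 \<beta> \<omega> p ?ts"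
      using eq pX unfolding form_eq_on_def form_eq_def by blast
    then have "wedge 1 2 (local_rep A c \<beta>' ?x) (local_rep A c \<omega> ?x) [u, v, w]
        = wedge 1 2 (local_rep A c \<beta> ?x) (local_rep A c \<omega> ?x) [u, v, w]"
      unfolding wedge_form_in_coordinates local_rep_chart[OF cp] .
    then show "wedge 1 2 (?g ?x) (local_rep A c \<omega> ?x) [u, v, w] = 0"
      unfolding expand by (simp add: algebra_simps)
  qed
  then show False
    using p(2) by (simp add: rank_at_def form_rank_in_coordinates[OF cp] local_rep_chart[OF cp])
qed

end

theorem theorem1:
  fixes X :: "'a topology"
    and A :: "('a, 'e::euclidean_space) chart set"
    and \<omega> \<beta> :: "('a, 'e) form"
    and \<A> \<B> \<C> :: "'a set"
  assumes "smooth_manifold X A"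
    and "connected_space X"
    and "DIM('e) \<ge> 4"
    and "smooth_form X A 2 \<omega>"
    and "smooth_form X A 1 \<beta>"
    and "form_eq_on (topspace X) A 3 (ext_deriv A 2 \<omega>) (wedge_form 1 2 \<beta> \<omega>)"
    and "nowhere_dense_in X {q \<in> topspace X. form_zero (tangent_space A q) 2 (\<omega> q)}"
    and "\<A> = {q \<in> topspace X. rank_at A \<omega> q > 2}"
    and "\<B> = {q \<in> topspace X. \<not> form_zero (tangent_space A q) 2 (ext_deriv A 1 \<beta> q) \<and>
                              \<not> form_zero (tangent_space A q) 2 (\<omega> q)}"
    and "\<C> = {q \<in> topspace X. rank_at A \<omega> q \<le> 1}"
  shows "(openin X \<A> \<and>
          (\<A> \<noteq> {} \<longrightarrow> (\<forall>q\<in>\<A>. form_zero (tangent_space A q) 2 (ext_deriv A 1 \<beta> q))))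
       \<and> (\<B> \<noteq> {} \<longrightarrow>
            (\<forall>q\<in>\<B>. 1 \<le> rank_at A (ext_deriv A 1 \<beta>) q \<and> rank_at A (ext_deriv A 1 \<beta>) q \<le> 2 \<and>
                     1 \<le> rank_at A \<omega> q \<and> rank_at A \<omega> q \<le> 2))
       \<and> (nowhere_dense_in X \<C> \<longrightarrow>
            (\<forall>\<beta>'. smooth_form X A 1 \<beta>' \<and>
                  form_eq_on (topspace X) A 3 (ext_deriv A 2 \<omega>) (wedge_form 1 2 \<beta>' \<omega>)
                  \<longrightarrow> form_eq_on (topspace X) A 1 \<beta>' \<beta>))
       \<and> \<A> \<inter> \<B> = {}"
proof -
  interpret manifold X A by unfold_locales (rule assms(1))
  note \<omega> = assms(4) and \<beta> = assms(5) and d\<omega> = assms(6)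
  note bounds = rank_bounds_of_ext_deriv_nonzero[OF \<omega> \<beta> d\<omega>]
  have "openin X \<A>" unfolding assms(8) by (rule openin_rank_gt[OF \<omega>])
  \<comment> \<open>Contraposition: d\<beta> \<noteq> 0 at \<open>q\<close> would bound the rank of
    \<omega> there by \<open>2\<close>.\<close>
  moreover have zero: "form_zero (tangent_space A q) 2 (ext_deriv A 1 \<beta> q)" if "q \<in> \<A>" for q
    using that bounds(2)[of q] unfolding assms(8) by fastforce
  moreover have "1 \<le> rank_at A (ext_deriv A 1 \<beta>) q \<and> rank_at A (ext_deriv A 1 \<beta>) q \<le> 2 \<and>
      1 \<le> rank_at A \<omega> q \<and> rank_at A \<omega> q \<le> 2" if "q \<in> \<B>" for q
    using that bounds[of q] unfolding assms(9) by blast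
  moreover have "form_eq_on (topspace X) A 1 \<beta>' \<beta>"
    if "nowhere_dense_in X \<C>" "smooth_form X A 1 \<beta>'"
      "form_eq_on (topspace X) A 3 (ext_deriv A 2 \<omega>) (wedge_form 1 2 \<beta>' \<omega>)" for \<beta>'
  proof (rule wedge_1_2_factor_unique[OF \<omega> \<beta> that(2)])
    show "form_eq_on (topspace X) A 3 (wedge_form 1 2 \<beta>' \<omega>) (wedge_form 1 2 \<beta> \<omega>)"
      using that(3) d\<omega> by (simp add: form_eq_on_def form_eq_def)
  qed (use that(1) assms(10) in simp)
  moreover have "\<A> \<inter> \<B> = {}" using zero unfolding assms(9) by blast
  ultimately show ?thesis by blast
qed

end
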